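(* Let $m$ be a positive integer with $m>\lceil d_\epsilon\rceil+\lceil \tilde d_{\tilde\epsilon}\rceil$. Then the composite Bernstein-Szegö basis $\psi^{(m)}_0,\ldots,\psi^{(m)}_m$ on the nodes $\xi^{(m)}_0,\ldots,\xi^{(m)}_m$ satisfies the orthogonality relations $$\sum_{0\leq \hat l\leq m}\psi^{(m)}_l\bigl(\xi^{(m)}_{\hat l}\bigr)\,\overline{\psi^{(m)}_k\bigl(\xi^{(m)}_{\hat l}\bigr)}\,\hat\Delta^{(m)}_{\hat l}=\begin{cases}1/\Delta^{(m)}_l&\text{if } k=l,\\ 0&\text{if } k\neq l\end{cases}\qquad (0\leq l,k\leq m),$$ or equivalently $$\sum_{0\leq l\leq m}\psi^{(m)}_l\bigl(\xi^{(m)}_{\hat l}\bigr)\,\overline{\psi^{(m)}_l\bigl(\xi^{(m)}_{\hat k}\bigr)}\,\Delta^{(m)}_{l}=\begin{cases}1/\hat\Delta^{(m)}_{\hat l}&\text{if } \hat k=\hat l,\\ 0&\text{if } \hat k\neq \hat l\end{cases}\qquad (0\leq \hat l,\hat k\leq m).$$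
   Context: **Parameters.** Fix nonnegative integers $d,\tilde d$, signs $\epsilon_\pm,\tilde\epsilon_\pm\in\{0,1\}$, and parameters $\alpha_1,\ldots,\alpha_d$ and $\tilde\alpha_1,\ldots,\tilde\alpha_{\tilde d}$ with $0<|\alpha_r|<1$, $0<|\tilde\alpha_r|<1$, where possible complex parameters among the $\alpha_r$ occur in complex conjugate pairs, and likewise for the $\tilde\alpha_r$. Put $d_\epsilon:=\frac12(d-\epsilon_+-\epsilon_-)$ and $\tilde d_{\tilde\epsilon}:=\frac12(\tilde d-\tilde\epsilon_+-\tilde\epsilon_-)$. **Bernstein-Szegö polynomials.** Let $$c(\xi):=(1+\epsilon_+e^{-i\xi})^{-1}(1-\epsilon_-e^{-i\xi})^{-1}\prod_{1\leq r\leq d}(1+\alpha_re^{-i\xi}),\qquad w(\xi):=\frac{1}{2\pi|c(\xi)|^2}\quad(0<\xi<\pi).$$ Let $p_l(\xi)$, $l=0,1,2,\ldots$, be the polynomials of degree $l$ in $\cos\xi$ obtained by Gram-Schmidt orthogonalization of $1,\ e^{i\xi}+e^{-i\xi},\ e^{2i\xi}+e^{-2i\xi},\ldots$ in $L^2((0,\pi),w(\xi)d\xi)$, normalized so that their expansion in these functions is unitriangular (leading coefficient 1). Put $\Delta_l:=\int_0^\pi p_l^2(\xi)w(\xi)\,d\xi$ and $\mathtt p_l(\xi):=\Delta_l^{-1}p_l(\xi)$. The objects $\tilde c(\xi)$, $\tilde\Delta_l$, $\tilde{\mathtt p}_l(\xi)$ are defined in the same way from $\tilde d,\tilde\epsilon_\pm,\tilde\alpha_r$.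 **Nodes.** For $|\alpha|<1$ let $u_\alpha(x):=\frac{1-\alpha^2}{1+2\alpha\cos(x)+\alpha^2}$. For a positive integer $m>\lceil d_\epsilon\rceil+\lceil\tilde d_{\tilde\epsilon}\rceil$ and $\hat l\in\{0,\ldots,m\}$, $\xi^{(m)}_{\hat l}$ denotes the unique real solution $\xi$ of $$2(m-d_\epsilon-\tilde d_{\tilde\epsilon})\xi+\sum_{1\leq r\leq d}\int_0^\xi u_{\alpha_r}(x)dx+\sum_{1\leq r\leq\tilde d}\int_0^\xi u_{\tilde\alpha_r}(x)dx=\pi(2\hat l+\epsilon_-+\tilde\epsilon_-).$$ One has $0\leq\xi^{(m)}_0<\xi^{(m)}_1<\cdots<\xi^{(m)}_m\leq\pi$, and the nodes are never poles of $c(\pm\xi)$ or $\tilde c(\pm\xi)$. **Composite basis.** For $\xi\in\{\xi^{(m)}_0,\ldots,\xi^{(m)}_m\}$ and $l\in\{0,\ldots,m\}$, $$\psi^{(m)}_l(\xi):=\begin{cases}e^{\frac i2m\xi}\,\dfrac{\mathtt p_l(\xi)}{c(-\xi)}&\text{if }0\leq l<d_\epsilon,\\[2mm] e^{\frac i2m\xi}\,\dfrac{\mathtt p_l(\xi)}{c(-\xi)}=e^{-\frac i2m\xi}\,\dfrac{\tilde{\mathtt p}_{m-l}(\xi)}{\tilde c(\xi)}&\text{if }d_\epsilon\leq l\leq m-\tilde d_{\tilde\epsilon},\\[2mm] e^{-\frac i2m\xi}\,\dfrac{\tilde{\mathtt p}_{m-l}(\xi)}{\tilde c(\xi)}&\text{if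 }m-\tilde d_{\tilde\epsilon}<l\leq m\end{cases}$$ (the two expressions in the middle case agree at the nodes). **Weights.** For $l,\hat l\in\{0,\ldots,m\}$, $$\Delta^{(m)}_l:=\begin{cases}\Delta_l&\text{if }0\leq l\leq d_\epsilon,\\1&\text{if }d_\epsilon<l<m-\tilde d_{\tilde\epsilon},\\\tilde\Delta_{m-l}&\text{if }m-\tilde d_{\tilde\epsilon}\leq l\leq m,\end{cases}$$ $$\hat\Delta^{(m)}_{\hat l}:=\left(\tfrac12\right)^{(1-\epsilon_-)(1-\tilde\epsilon_-)\delta_{\hat l}+(1-\epsilon_+)(1-\tilde\epsilon_+)\delta_{m-\hat l}}\Bigl(2(m-d_\epsilon-\tilde d_{\tilde\epsilon})+\sum_{1\leq r\leq d}u_{\alpha_r}(\xi^{(m)}_{\hat l})+\sum_{1\leq r\leq\tilde d}u_{\tilde\alpha_r}(\xi^{(m)}_{\hat l})\Bigr)^{-1},$$ where $\delta_x:=1$ if $x=0$ and $\delta_x:=0$ otherwise. The superscript $(m)$ is a label, not a derivative. *)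

theory Defs
  imports "HOL-Analysis.Analysis"
begin

text \<open>
  The data (d, \<epsilon>+, \<epsilon>-, \<alpha>) of one Bernstein-Szegoe family; only the values
  \<alpha> 1, ..., \<alpha> d of the parameter function are ever used.
\<close>

record bs_params =
  bs_d :: nat
  eps_plus :: nat
  eps_minus :: nat
  bs_alpha :: "nat \<Rightarrow> complex"

text \<open>
  The last conjunct says that non-real parameters occur in complex conjugate pairs, counted
  with multiplicity.
\<close>

definition bs_admissible :: "bs_params \<Rightarrow> bool" where
  "bs_admissible P \<longleftrightarrow>
     eps_plus P \<in> {0, 1} \<and> eps_minus P \<in> {0, 1} \<and>
     (\<forall>r\<in>{1..bs_d P}. 0 < cmod (bs_alpha P r) \<and> cmod (bs_alpha P r) < 1) \<and>
     (\<forall>z. card {r \<in> {1..bs_d P}. bs_alpha P r = z}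
        = card {r \<in> {1..bs_d P}. bs_alpha P r = cnj z})"

definition d_eps :: "bs_params \<Rightarrow> real" where
  "d_eps P = (real (bs_d P) - real (eps_plus P) - real (eps_minus P)) / 2"

definition bs_c :: "bs_params \<Rightarrow> real \<Rightarrow> complex" where
  "bs_c P \<xi> =
     inverse (1 + of_nat (eps_plus P) * exp (- \<i> * of_real \<xi>)) *
     inverse (1 - of_nat (eps_minus P) * exp (- \<i> * of_real \<xi>)) *
     (\<Prod>r=1..bs_d P. 1 + bs_alpha P r * exp (- \<i> * of_real \<xi>))"

definition bs_weight :: "bs_params \<Rightarrow> real \<Rightarrow> real" where
  "bs_weight P \<xi> = 1 / (2 * pi * (cmod (bs_c P \<xi>))\<^sup>2)"

definition bs_inner :: "bs_params \<Rightarrow> (real \<Rightarrow> real) \<Rightarrow> (real \<Rightarrow> real) \<Rightarrow> real" where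
  "bs_inner P f g = (LBINT \<xi>=0..pi. f \<xi> * g \<xi> * bs_weight P \<xi>)"

text \<open>
  The functions 1 and \<open>exp (i l \<xi>) + exp (- i l \<xi>)\<close> for l > 0, written as real functions.
  At l = 0 the value is 1, not 2.
\<close>

definition cos_basis :: "nat \<Rightarrow> real \<Rightarrow> real" where
  "cos_basis l \<xi> = (if l = 0 then 1 else 2 * cos (real l * \<xi>))"

text \<open>
  Gram-Schmidt without rescaling, so that the expansion in \<^const>\<open>cos_basis\<close> is unitriangular.
  All functions involved are real-valued, hence no conjugation in \<^const>\<open>bs_inner\<close>.
\<close>

context
  notes sum.cong [fundef_cong]
begin

fun bs_p :: "bs_params \<Rightarrow> nat \<Rightarrow> real \<Rightarrow> real" where
  "bs_p P l = (\<lambda>\<xi>. cos_basis l \<xi> -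
     (\<Sum>k\<in>{..<l}. bs_inner P (cos_basis l) (bs_p P k) / bs_inner P (bs_p P k) (bs_p P k)
        * bs_p P k \<xi>))"

end

declare bs_p.simps [simp del]

definition bs_Delta :: "bs_params \<Rightarrow> nat \<Rightarrow> real" where
  "bs_Delta P l = (LBINT \<xi>=0..pi. (bs_p P l \<xi>)\<^sup>2 * bs_weight P \<xi>)"

definition bs_pp :: "bs_params \<Rightarrow> nat \<Rightarrow> real \<Rightarrow> real" where
  "bs_pp P l \<xi> = inverse (bs_Delta P l) * bs_p P l \<xi>"

text \<open>
  For non-real \<alpha> the value is non-real in general; only the sum over all parameters of an
  admissible family is real.
\<close>

definition u_fun :: "complex \<Rightarrow> real \<Rightarrow> complex" where
  "u_fun \<alpha> x = (1 - \<alpha>\<^sup>2) / (1 + 2 * \<alpha> * of_real (cos x) + \<alpha>\<^sup>2)"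

text \<open>
  The interval integral is oriented, so the equation is also meaningful for \<xi> < 0 and
  \<open>bs_node\<close> selects the unique solution among all reals.
\<close>

definition is_bs_node :: "bs_params \<Rightarrow> bs_params \<Rightarrow> nat \<Rightarrow> nat \<Rightarrow> real \<Rightarrow> bool" where
  "is_bs_node P Q m j \<xi> \<longleftrightarrow>
     of_real (2 * (real m - d_eps P - d_eps Q) * \<xi>)
     + (\<Sum>r=1..bs_d P. LBINT x=0..\<xi>. u_fun (bs_alpha P r) x)
     + (\<Sum>r=1..bs_d Q. LBINT x=0..\<xi>. u_fun (bs_alpha Q r) x)
     = complex_of_real (pi * real (2 * j + eps_minus P + eps_minus Q))"

definition bs_node :: "bs_params \<Rightarrow> bs_params \<Rightarrow> nat \<Rightarrow> nat \<Rightarrow> real" where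
  "bs_node P Q m j = (THE \<xi>. is_bs_node P Q m j \<xi>)"

text \<open>
  P carries the data without tilde, Q the data with tilde.  In the middle range
  \<open>d_eps P \<le> l \<le> m - d_eps Q\<close> both expressions below agree at the nodes (though not at other
  arguments), and the first one is taken there.  The case l < d_eps P is covered by the first
  branch, because d_eps P < m - d_eps Q for the m under consideration.
\<close>

definition bs_psi :: "bs_params \<Rightarrow> bs_params \<Rightarrow> nat \<Rightarrow> nat \<Rightarrow> real \<Rightarrow> complex" where
  "bs_psi P Q m l \<xi> =
     (if real l \<le> real m - d_eps Q
      then exp (\<i> / 2 * of_nat m * of_real \<xi>) * (of_real (bs_pp P l \<xi>) / bs_c P (- \<xi>))
      else exp (- \<i> / 2 * of_nat m * of_real \<xi>) * (of_real (bs_pp Q (m - l) \<xi>) / bs_c Q \<xi>))"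

definition bs_Delta_m :: "bs_params \<Rightarrow> bs_params \<Rightarrow> nat \<Rightarrow> nat \<Rightarrow> real" where
  "bs_Delta_m P Q m l =
     (if real l \<le> d_eps P then bs_Delta P l
      else if real l < real m - d_eps Q then 1
      else bs_Delta Q (m - l))"

definition bs_hat_Delta :: "bs_params \<Rightarrow> bs_params \<Rightarrow> nat \<Rightarrow> nat \<Rightarrow> complex" where
  "bs_hat_Delta P Q m j =
     (1 / 2) ^ ((1 - eps_minus P) * (1 - eps_minus Q) * of_bool (j = 0)
              + (1 - eps_plus P) * (1 - eps_plus Q) * of_bool (m - j = 0)) *
     inverse (of_real (2 * (real m - d_eps P - d_eps Q))
       + (\<Sum>r=1..bs_d P. u_fun (bs_alpha P r) (bs_node P Q m j))
       + (\<Sum>r=1..bs_d Q. u_fun (bs_alpha Q r) (bs_node P Q m j)))"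

end

theory Submission
  imports Defs "HOL-Complex_Analysis.Complex_Analysis" "Jordan_Normal_Form.Determinant"
begin

text \<open>
  For \<open>l \<ge> d_eps P\<close> the normalised orthogonal polynomial is
  \<open>c(\<xi>) e^{il\<xi>} + c(-\<xi>) e^{-il\<xi>}\<close>: against \<open>e^{ik\<xi>} + e^{-ik\<xi>}\<close> with \<open>k \<le> l\<close> the weight
  cancels one factor \<open>c\<close> and leaves the mean value over the unit circle of a function that is
  holomorphic in the disc.  Since \<open>c(\<xi>) / c(-\<xi>) = e^{i phase(\<xi>)}\<close> with an explicit real phase, the
  basis functions of P become \<open>2 cos (l\<xi> + phase/2)\<close> up to a common factor, those of Q likewise,
  and the node equation says exactly that the cosines of the two families match up to sign.

  The dual relation (sum over l) is obtained by cutting the sum at an index where both expressions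
  are valid and applying the Christoffel-Darboux formula to either part: off the diagonal the two
  boundary terms cancel at the nodes; on the diagonal the confluent form leaves the derivative of
  the node equation, which is doubled at the endpoints 0 and \<open>\<pi>\<close>.  The relation for the sum over the
  nodes follows because a one-sided inverse of a square matrix is two-sided.
\<close>

hide_const (open) Module.module.smult


section \<open>Two-sided inverses of square matrices\<close>

lemma biorthogonal_flip:
  fixes M K :: "nat \<Rightarrow> nat \<Rightarrow> 'a::field"
  assumes "\<And>i j. i < n \<Longrightarrow> j < n \<Longrightarrow> (\<Sum>l<n. M i l * K l j) = (if i = j then 1 else 0)"
    and "i < n" "j < n"
  shows "(\<Sum>l<n. K i l * M l j) = (if i = j then 1 else 0)"
proof -
  define A where "A = mat n n (\<lambda>(i, j). M i j)"
  define B where "B = mat n n (\<lambda>(i, j). K i j)"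
  have A: "A \<in> carrier_mat n n" and B: "B \<in> carrier_mat n n"
    by (auto simp: A_def B_def)
  have "A * B = 1\<^sub>m n"
    using assms(1)
    by (intro eq_matI) (auto simp: A_def B_def scalar_prod_def lessThan_atLeast0)
  from mat_mult_left_right_inverse[OF A B this] have "(B * A) $$ (i, j) = 1\<^sub>m n $$ (i, j)"
    by simp
  then show ?thesis
    using assms(2,3) by (auto simp: A_def B_def scalar_prod_def lessThan_atLeast0)
qed

subsection \<open>Monic orthogonal polynomials\<close>

text \<open>The recurrence theory rests on linearity and strict positivity of the functional;
  working with polynomials detaches it from the integral and serves both families at once.\<close>

locale monic_orthogonal =
  fixes L :: "real poly \<Rightarrow> real" and p :: "nat \<Rightarrow> real poly"
  assumes L_add: "L (f + g) = L f + L g"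
    and L_smult: "L (smult c f) = c * L f"
    and L_pos: "f \<noteq> 0 \<Longrightarrow> L (f * f) > 0"
    and p_coeff_gt: "l < i \<Longrightarrow> coeff (p l) i = 0"
    and p_coeff_eq: "coeff (p l) l = 1"
    and p_orth: "k < l \<Longrightarrow> L (p l * p k) = 0"
begin

definition h :: "nat \<Rightarrow> real" where "h l = L (p l * p l)"

lemma p_nonzero: "p l \<noteq> 0"
  using p_coeff_eq[of l] by auto

lemma h_pos: "h l > 0"
  using L_pos[OF p_nonzero] by (simp add: h_def)

lemma L_0: "L 0 = 0"
  using L_smult[of 0 0] by simp

lemma L_minus: "L (f - g) = L f - L g"
  using L_add[of "f - g" g] by simp

text \<open>Subtracting the multiple of \<open>b d\<close> that removes the coefficient of degree
  \<open>d\<close> lowers the degree bound of \<open>g\<close>. The unitriangular family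
  \<open>b\<close> is arbitrary because the lemma is applied both to \<open>p\<close> and to
  \<open>cos_poly\<close>.\<close>

lemma L_orth_span:
  assumes b: "\<And>k i. k < n \<Longrightarrow> k < i \<Longrightarrow> coeff (b k) i = 0" "\<And>k. k < n \<Longrightarrow> coeff (b k) k = 1"
    and orth: "\<And>k. k < n \<Longrightarrow> L (f * b k) = 0"
    and g: "\<And>i. n \<le> i \<Longrightarrow> coeff g i = 0"
  shows "L (f * g) = 0"
proof -
  have "(\<forall>i\<ge>d. coeff g i = 0) \<Longrightarrow> d \<le> n \<Longrightarrow> L (f * g) = 0" for d g
  proof (induction d arbitrary: g)
    case 0
    then have "g = 0" by (intro poly_eqI) auto
    then show ?case by (simp add: L_0)
  next
    case (Suc d)
    define r where "r = g - smult (coeff g d) (b d)"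
    have "\<forall>i\<ge>d. coeff r i = 0"
    proof (intro allI impI)
      fix i assume "d \<le> i"
      then show "coeff r i = 0"
        using Suc.prems b[of d] by (cases "i = d") (auto simp: r_def)
    qed
    then have "L (f * r) = 0"
      using Suc by auto
    moreover have "f * g = f * r + smult (coeff g d) (f * b d)"
      by (simp add: r_def algebra_simps)
    ultimately show ?case
      using Suc.prems orth[of d] by (simp add: L_add L_smult)
  qed
  then show ?thesis using g by blast
qed

lemma p_orth_lower:
  assumes "\<And>i. l \<le> i \<Longrightarrow> coeff g i = 0"
  shows "L (p l * g) = 0"
  by (rule L_orth_span[where b = p and n = l]) (use assms p_coeff_gt p_coeff_eq p_orth in auto)

lemma zero_if_orth_all:
  assumes "\<And>i. l < i \<Longrightarrow> coeff f i = 0" and "\<And>k. k \<le> l \<Longrightarrow> L (f * p k) = 0"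
  shows "f = 0"
proof -
  have "L (f * f) = 0"
    by (rule L_orth_span[where b = p and n = "Suc l"])
      (use assms p_coeff_gt p_coeff_eq in auto)
  then show ?thesis using L_pos[of f] by fastforce
qed

text \<open>After subtraction of the multiple of \<open>p l\<close> the remainder has degree below
  \<open>l\<close>, hence is orthogonal to \<open>p l\<close>, and it is orthogonal to the earlier
  members by assumption. This later identifies explicit polynomials with the Gram-Schmidt ones up to
  a factor.\<close>

lemma orth_lower_unique:
  assumes q: "\<And>i. l < i \<Longrightarrow> coeff q i = 0" and orth: "\<And>k. k < l \<Longrightarrow> L (q * p k) = 0"
  shows "q = smult (coeff q l) (p l)"
proof -
  define r where "r = q - smult (coeff q l) (p l)"
  have r: "coeff r i = 0" if "l \<le> i" for i
    using that q[of i] p_coeff_gt[of l i] p_coeff_eq[of l] by (cases "i = l") (auto simp: r_def)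
  have "r = 0"
  proof (rule zero_if_orth_all[where l = l])
    show "L (r * p k) = 0" if "k \<le> l" for k
    proof (cases "k = l")
      case True
      then show ?thesis using p_orth_lower[of l r] r by (simp add: mult.commute)
    next
      case False
      then have "k < l" using that by simp
      then show ?thesis
        using orth p_orth by (simp add: r_def L_minus L_smult left_diff_distrib)
    qed
  qed (use r in auto)
  then show ?thesis by (simp add: r_def)
qed

text \<open>Both \<open>[:0, 1:] * p k\<close> and \<open>p (Suc k)\<close> are monic of degree
  \<open>Suc k\<close>, and \<open>p (Suc k)\<close> is orthogonal to their difference.\<close>

lemma L_X_mult_p: "L ([:0, 1:] * p k * p (Suc k)) = h (Suc k)"
proof -
  have "L (p (Suc k) * ([:0, 1:] * p k - p (Suc k))) = 0"
  proof (rule p_orth_lower)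
    fix i assume "Suc k \<le> i"
    then show "coeff ([:0, 1:] * p k - p (Suc k)) i = 0"
      using p_coeff_eq[of k] p_coeff_eq[of "Suc k"] p_coeff_gt[of k "i - 1"] p_coeff_gt[of "Suc k" i]
      by (cases "i = Suc k"; cases i) auto
  qed
  moreover have "p (Suc k) * ([:0, 1:] * p k - p (Suc k)) = [:0, 1:] * p k * p (Suc k) - p (Suc k) * p (Suc k)"
    by (simp add: algebra_simps)
  ultimately show ?thesis by (simp add: L_minus h_def)
qed

text \<open>The difference of the two sides has degree at most \<open>l\<close> and is orthogonal to
  all of \<open>p 0\<close>, ..., \<open>p l\<close>. The constant \<open>b\<close> stays anonymous
  because it cancels in the Christoffel-Darboux formula.\<close>

lemma three_term:
  obtains b where "p (Suc l) = [:0, 1:] * p l - smult b (p l)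
     - (if l = 0 then 0 else smult (h l / h (l - 1)) (p (l - 1)))"
proof -
  define b where "b = L ([:0, 1:] * p l * p l) / h l"
  define a where "a = (if l = 0 then 0 else smult (h l / h (l - 1)) (p (l - 1)))"
  define r where "r = [:0, 1:] * p l - smult b (p l) - a - p (Suc l)"
  have hl: "h k \<noteq> 0" for k using h_pos[of k] by simp
  have "r = 0"
  proof (rule zero_if_orth_all[where l = l])
    fix i assume i: "l < i"
    then have "coeff a i = 0" using p_coeff_gt[of "l - 1" i] by (auto simp: a_def)
    then show "coeff r i = 0"
      using i p_coeff_eq[of l] p_coeff_eq[of "Suc l"] p_coeff_gt[of l "i - 1"]
        p_coeff_gt[of l i] p_coeff_gt[of "Suc l" i]
      by (cases "i = Suc l"; cases i) (auto simp: r_def)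
  next
    fix k assume k: "k \<le> l"
    have "L (p (Suc l) * p k) = 0" using k p_orth by auto
    moreover have "r * p k = [:0, 1:] * p l * p k - smult b (p l * p k) - a * p k - p (Suc l) * p k"
      by (simp add: r_def algebra_simps)
    ultimately have rk: "L (r * p k) = L ([:0, 1:] * p l * p k) - b * L (p l * p k) - L (a * p k)"
      by (simp add: L_minus L_smult)
    \<comment> \<open>The first case fixes \<open>b\<close>, the second the ratio of the norms; in
      the third \<open>[:0, 1:] * p k\<close> has degree below \<open>l\<close>.\<close>
    consider "k = l" | "Suc k = l" | "Suc k < l" using k by linarith
    then show "L (r * p k) = 0"
    proof cases
      case 1
      then have "L (a * p k) = 0" using p_orth[of "l - 1" l] by (auto simp: a_def L_0 L_smult mult.commute)
      then show ?thesis using hl[of l] rk by (simp add: 1 b_def h_def del: mult_pCons_left)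
    next
      case 2
      then have "L (a * p k) = h l" using hl by (auto simp: a_def L_smult h_def)
      moreover have "L ([:0, 1:] * p l * p k) = h l"
        using L_X_mult_p[of k] 2 by (simp only: mult_ac)
      ultimately show ?thesis
        using 2 p_orth[of k l] by (simp add: rk del: mult_pCons_left)
    next
      case 3
      then have "L (a * p k) = 0" using p_orth[of k "l - 1"] by (auto simp: a_def L_0 L_smult)
      have X: "L (p l * ([:0, 1:] * p k)) = 0"
        by (rule p_orth_lower)
          (use 3 p_coeff_gt[of k] in \<open>auto simp: coeff_pCons split: nat.splits\<close>)
      have "L ([:0, 1:] * p l * p k) = 0"
        using X by (simp only: mult_ac)
      with \<open>L (a * p k) = 0\<close> show ?thesis using 3 p_orth[of k l] by (simp add: rk del: mult_pCons_left)
    qed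
  qed
  then have "p (Suc l) = [:0, 1:] * p l - smult b (p l) - a" by (simp add: r_def)
  then show thesis using that by (simp add: a_def)
qed

text \<open>Induction with the recurrence at \<open>x\<close> and at \<open>y\<close>: the
  \<open>b\<close> terms cancel by antisymmetry, and the terms with \<open>h (Suc n) / h n\<close>
  reproduce the previous boundary expression.\<close>

lemma Christoffel_Darboux:
  "(x - y) * (\<Sum>l<Suc n. poly (p l) x * poly (p l) y / h l) =
     (poly (p (Suc n)) x * poly (p n) y - poly (p n) x * poly (p (Suc n)) y) / h n"
proof (induction n)
  case 0
  obtain b where b: "p (Suc 0) = [:0, 1:] * p 0 - smult b (p 0)"
    using three_term[of 0] by auto
  show ?case by (simp add: b algebra_simps diff_divide_distrib)
next
  case (Suc n)
  obtain b where b: "p (Suc (Suc n)) = [:0, 1:] * p (Suc n) - smult b (p (Suc n))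
     - smult (h (Suc n) / h n) (p n)"
    using three_term[of "Suc n"] by auto
  have hl: "h k \<noteq> 0" for k using h_pos[of k] by simp
  have "(x - y) * (\<Sum>l<Suc (Suc n). poly (p l) x * poly (p l) y / h l) =
    (poly (p (Suc n)) x * poly (p n) y - poly (p n) x * poly (p (Suc n)) y) / h n
     + (x - y) * (poly (p (Suc n)) x * poly (p (Suc n)) y / h (Suc n))"
    by (subst sum.lessThan_Suc, subst distrib_left, subst Suc.IH) simp
  also have "\<dots> = (poly (p (Suc (Suc n))) x * poly (p (Suc n)) y
       - poly (p (Suc n)) x * poly (p (Suc (Suc n))) y) / h (Suc n)"
    unfolding b using hl[of n] hl[of "Suc n"] by (simp add: field_simps)
  finally show ?case .
qed

end

subsection \<open>The phase of the c-function\<close>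

abbreviation zexp :: "real \<Rightarrow> complex" where
  "zexp x \<equiv> exp (\<i> * of_real x)"

lemma exp_minus_i_eq_cnj: "exp (- \<i> * of_real x) = cnj (zexp x)"
  by (simp add: exp_cnj)

lemma zexp_mult_cnj [simp]: "zexp x * cnj (zexp x) = 1" "cnj (zexp x) * zexp x = 1"
  by (simp_all flip: exp_minus_i_eq_cnj add: exp_minus)

lemma norm_zexp_mult [simp]: "cmod (a * zexp x) = cmod a" "cmod (a * cnj (zexp x)) = cmod a"
  by (simp_all add: norm_mult)

lemma one_plus_nonzero: "cmod w < 1 \<Longrightarrow> 1 + w \<noteq> 0"
  by (metis add_eq_0_iff less_irrefl norm_minus_cancel norm_one)

lemma one_plus_notin_nonpos_Reals: "cmod w < 1 \<Longrightarrow> 1 + w \<notin> \<real>\<^sub>\<le>\<^sub>0"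
  using abs_Re_le_cmod[of w] by (auto simp: complex_nonpos_Reals_iff)

text \<open>Partial fractions in e^{ix}, the form from which both positivity and a logarithmic
  antiderivative can be read off.\<close>

lemma u_fun_eq: 
  assumes "cmod \<alpha> < 1"
  shows "u_fun \<alpha> x = 1 / (1 + \<alpha> * zexp x) + 1 / (1 + \<alpha> * cnj (zexp x)) - 1"
proof -
  have "1 + \<alpha> * zexp x \<noteq> 0" "1 + \<alpha> * cnj (zexp x) \<noteq> 0"
    using assms by (auto intro!: one_plus_nonzero)
  moreover have "2 * complex_of_real (cos x) = zexp x + cnj (zexp x)"
    by (simp add: complex_eq_iff Re_exp Im_exp)
  then have "1 + 2 * \<alpha> * of_real (cos x) + \<alpha>\<^sup>2 = (1 + \<alpha> * zexp x) * (1 + \<alpha> * cnj (zexp x))"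
    by (simp add: algebra_simps power2_eq_square)
  moreover have "1 - \<alpha>\<^sup>2 = (1 + \<alpha> * zexp x) + (1 + \<alpha> * cnj (zexp x)) - (1 + \<alpha> * zexp x) * (1 + \<alpha> * cnj (zexp x))"
    by (simp add: algebra_simps power2_eq_square)
  moreover have "(a + b - a * b) / (a * b) = 1 / a + 1 / b - 1" if "a \<noteq> 0" "b \<noteq> 0" for a b :: complex
    using that by (simp add: field_simps)
  ultimately show ?thesis
    unfolding u_fun_def by (simp only: not_False_eq_True)
qed

lemma u_fun_cnj: "u_fun (cnj \<alpha>) x = cnj (u_fun \<alpha> x)"
  by (simp add: u_fun_def)

text \<open>Inversion sends the disc of radius 1 around 1, whose boundary passes through 0, to a
  half plane.\<close>

lemma Re_inverse_one_plus:
  assumes "cmod w < 1" shows "Re (1 / (1 + w)) > 1 / 2"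
proof -
  have "(cmod w)\<^sup>2 < 1" using assms by (simp add: abs_square_less_1)
  then have "(Re w)\<^sup>2 + (Im w)\<^sup>2 < 1" by (simp add: cmod_power2)
  moreover have "(1 + Re w)\<^sup>2 + (Im w)\<^sup>2 > 0"
    using one_plus_nonzero[OF assms] by (auto simp: sum_power2_gt_zero_iff complex_eq_iff)
  ultimately show ?thesis
    by (simp add: Re_divide field_simps power2_eq_square)
qed

lemma Re_u_fun_pos: 
  assumes "cmod \<alpha> < 1" shows "Re (u_fun \<alpha> x) > 0"
  using Re_inverse_one_plus[of "\<alpha> * zexp x"] Re_inverse_one_plus[of "\<alpha> * cnj (zexp x)"] assms
  by (simp add: u_fun_eq)

lemma continuous_u_fun:
  assumes "cmod \<alpha> < 1" shows "continuous_on A (u_fun \<alpha>)"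
proof -
  have "1 + \<alpha> * zexp x \<noteq> 0" "1 + \<alpha> * cnj (zexp x) \<noteq> 0" for x
    using assms by (auto intro!: one_plus_nonzero)
  then show ?thesis
    unfolding u_fun_eq[OF assms, abs_def] by (intro continuous_intros) auto
qed

text \<open>An antiderivative of \<^const>\<open>u_fun\<close> in closed form; the principal logarithm is harmless
  because \<open>Re (1 + \<alpha> z) > 0\<close> on the unit circle.\<close>

definition u_int :: "complex \<Rightarrow> real \<Rightarrow> complex" where
  "u_int \<alpha> x = of_real x - \<i> * (Ln (1 + \<alpha> * cnj (zexp x)) - Ln (1 + \<alpha> * zexp x))"

lemma u_int_0 [simp]: "u_int \<alpha> 0 = 0"
  by (simp add: u_int_def)

lemma u_int_pi [simp]: "u_int \<alpha> pi = of_real pi"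
  by (simp add: u_int_def)

lemma u_int_cnj:
  assumes "cmod \<alpha> < 1" shows "u_int (cnj \<alpha>) x = cnj (u_int \<alpha> x)"
proof -
  have "cnj (Ln (1 + \<alpha> * zexp x)) = Ln (1 + cnj \<alpha> * cnj (zexp x))"
    "cnj (Ln (1 + \<alpha> * cnj (zexp x))) = Ln (1 + cnj \<alpha> * zexp x)"
    using assms by (subst cnj_Ln; simp add: one_plus_notin_nonpos_Reals)+
  then show ?thesis by (simp add: u_int_def algebra_simps)
qed

lemma exp_i_u_int:
  assumes "cmod \<alpha> < 1"
  shows "exp (\<i> * u_int \<alpha> x) = zexp x * (1 + \<alpha> * cnj (zexp x)) / (1 + \<alpha> * zexp x)"
proof -
  have "1 + \<alpha> * zexp x \<noteq> 0" "1 + \<alpha> * cnj (zexp x) \<noteq> 0"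
    using assms by (auto intro!: one_plus_nonzero)
  moreover have "\<i> * u_int \<alpha> x = \<i> * of_real x + (Ln (1 + \<alpha> * cnj (zexp x)) - Ln (1 + \<alpha> * zexp x))"
    by (simp add: u_int_def algebra_simps)
  ultimately show ?thesis by (simp add: exp_add exp_diff)
qed

lemma u_int_deriv:
  assumes "cmod \<alpha> < 1"
  shows "(u_int \<alpha> has_vector_derivative u_fun \<alpha> x) (at x within A)"
proof -
  \<comment> \<open>\<open>exp (- \<i> * w)\<close> continues \<open>cnj (zexp x)\<close>
    holomorphically, so the complex chain rule applies to \<open>G\<close> before it is restricted
    to the real line.\<close>
  define G where "G w = w - \<i> * (Ln (1 + \<alpha> * exp (- \<i> * w)) - Ln (1 + \<alpha> * exp (\<i> * w)))" for w :: complex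
  have n1: "1 + \<alpha> * zexp x \<noteq> 0" "1 + \<alpha> * cnj (zexp x) \<noteq> 0"
    using assms by (auto intro!: one_plus_nonzero)
  have n2: "1 + \<alpha> * zexp x \<notin> \<real>\<^sub>\<le>\<^sub>0" "1 + \<alpha> * cnj (zexp x) \<notin> \<real>\<^sub>\<le>\<^sub>0"
    using assms by (auto intro!: one_plus_notin_nonpos_Reals)
  have "(G has_field_derivative
      1 - \<i> * (\<alpha> * (cnj (zexp x) * - \<i>) / (1 + \<alpha> * cnj (zexp x)) - \<alpha> * (zexp x * \<i>) / (1 + \<alpha> * zexp x))) (at (of_real x))"
    unfolding G_def using n2 
    by (auto intro!: derivative_eq_intros simp: divide_inverse mult_ac simp flip: exp_minus_i_eq_cnj)
  also have "1 - \<i> * (\<alpha> * (cnj (zexp x) * - \<i>) / (1 + \<alpha> * cnj (zexp x)) - \<alpha> * (zexp x * \<i>) / (1 + \<alpha> * zexp x)) = u_fun \<alpha> x"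
    using n1 by (simp add: u_fun_eq[OF assms] divide_simps) (simp add: algebra_simps)
  finally have "((\<lambda>x. G (of_real x)) has_vector_derivative u_fun \<alpha> x) (at x within A)"
    by (rule has_vector_derivative_real_field)
  moreover have "(\<lambda>x. G (of_real x)) = u_int \<alpha>"
    by (simp add: fun_eq_iff G_def u_int_def flip: exp_minus_i_eq_cnj)
  ultimately show ?thesis by simp
qed

lemma LBINT_u_fun:
  assumes "cmod \<alpha> < 1"
  shows "(LBINT x=0..\<xi>. u_fun \<alpha> x) = u_int \<alpha> \<xi>"
  using interval_integral_FTC_finite[of 0 \<xi> "u_fun \<alpha>" "u_int \<alpha>"] u_int_deriv[OF assms]
    continuous_u_fun[OF assms]
  by (simp add: zero_ereal_def)

section \<open>Conjugation symmetry of the parameters and the factors of c\<close>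

lemma bs_admissibleD:
  assumes "bs_admissible P"
  shows "eps_plus P = 0 \<or> eps_plus P = 1" "eps_minus P = 0 \<or> eps_minus P = 1"
    "\<And>r. r \<in> {1..bs_d P} \<Longrightarrow> cmod (bs_alpha P r) < 1"
  using assms by (auto simp: bs_admissible_def)

text \<open>Admissibility counts conjugate parameters with multiplicity, which is an equality of
  multisets; sums and products over the parameters are therefore unchanged when every parameter is
  conjugated.\<close>

lemma image_mset_cnj_alpha:
  assumes "bs_admissible P"
  shows "image_mset (\<lambda>r. cnj (bs_alpha P r)) (mset_set {1..bs_d P}) = image_mset (bs_alpha P) (mset_set {1..bs_d P})"
proof (rule multiset_eqI)
  fix z :: complex
  have *: "count (image_mset f (mset_set {1..bs_d P})) z = card {r \<in> {1..bs_d P}. f r = z}" for f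
    by (simp add: count_image_mset_eq_card_vimage)
  have "{r \<in> {1..bs_d P}. cnj (bs_alpha P r) = z} = {r \<in> {1..bs_d P}. bs_alpha P r = cnj z}"
    using complex_cnj_cancel_iff by (intro Collect_cong) (metis complex_cnj_cnj)
  then show "count (image_mset (\<lambda>r. cnj (bs_alpha P r)) (mset_set {1..bs_d P})) z = 
      count (image_mset (bs_alpha P) (mset_set {1..bs_d P})) z"
    using assms unfolding * bs_admissible_def by metis
qed

lemma sum_cnj_alpha:
  assumes "bs_admissible P"
  shows "(\<Sum>r=1..bs_d P. g (cnj (bs_alpha P r))) = (\<Sum>r=1..bs_d P. g (bs_alpha P r))"
  using arg_cong[OF image_mset_cnj_alpha[OF assms], of "\<lambda>M. sum_mset (image_mset g M)"]
  by (simp add: sum_unfold_sum_mset image_mset.compositionality comp_def)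

lemma prod_cnj_alpha:
  assumes "bs_admissible P"
  shows "(\<Prod>r=1..bs_d P. g (cnj (bs_alpha P r))) = (\<Prod>r=1..bs_d P. g (bs_alpha P r))"
  using arg_cong[OF image_mset_cnj_alpha[OF assms], of "\<lambda>M. prod_mset (image_mset g M)"]
  by (simp add: prod_unfold_prod_mset image_mset.compositionality comp_def)

text \<open>With \<open>den\<close>, this splits \<open>bs_c P x\<close> into a quotient taken at
  \<open>cnj (zexp x)\<close>. As polynomials in \<open>z\<close> both factors extend to the disc,
  where Cauchy's formula is applied.\<close>

definition num :: "bs_params \<Rightarrow> complex \<Rightarrow> complex" where
  "num P z = (\<Prod>r=1..bs_d P. 1 + bs_alpha P r * z)"

definition den :: "bs_params \<Rightarrow> complex \<Rightarrow> complex" where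
  "den P z = (1 + of_nat (eps_plus P) * z) * (1 - of_nat (eps_minus P) * z)"

lemma num_cnj: "bs_admissible P \<Longrightarrow> cnj (num P z) = num P (cnj z)"
  using prod_cnj_alpha[of P "\<lambda>a. 1 + a * cnj z"] by (simp add: num_def)

lemma den_cnj: "cnj (den P z) = den P (cnj z)"
  by (simp add: den_def)

lemma num_nonzero:
  assumes "bs_admissible P" "cmod z \<le> 1" shows "num P z \<noteq> 0"
proof -
  have "cmod (bs_alpha P r * z) < 1" if "r \<in> {1..bs_d P}" for r
    using bs_admissibleD(3)[OF assms(1) that] mult_left_le[OF assms(2), of "cmod (bs_alpha P r)"]
    by (simp add: norm_mult)
  then show ?thesis unfolding num_def using one_plus_nonzero by (subst prod_zero_iff) blast+
qed

lemma bs_c_eq: "bs_c P \<xi> = num P (cnj (zexp \<xi>)) / den P (cnj (zexp \<xi>))"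
  unfolding bs_c_def exp_minus_i_eq_cnj num_def den_def by (simp add: field_simps)

lemma bs_c_minus: "bs_admissible P \<Longrightarrow> bs_c P (- \<xi>) = cnj (bs_c P \<xi>)"
proof -
  assume "bs_admissible P"
  moreover have "zexp (- \<xi>) = cnj (zexp \<xi>)" by (simp add: exp_cnj)
  ultimately show ?thesis by (simp add: bs_c_eq num_cnj den_cnj)
qed

text \<open>Also true at the poles of \<open>c\<close>, where the totalised inverse makes both sides vanish.\<close>

lemma bs_weight_eq: "bs_weight P \<xi> = (cmod (den P (zexp \<xi>)))\<^sup>2 / (2 * pi * (cmod (num P (zexp \<xi>)))\<^sup>2)"
  if "bs_admissible P"
proof -
  have "cmod (num P (cnj z)) = cmod (num P z)" "cmod (den P (cnj z)) = cmod (den P z)" for z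
    by (metis complex_mod_cnj num_cnj den_cnj that)+
  then show ?thesis unfolding bs_weight_def bs_c_eq
    by (simp add: norm_divide power_divide)
qed

text \<open>For admissible data the sum is real already, since conjugate parameters pair up
  (\<open>of_real_u_total\<close>); \<open>Re\<close> only changes the type. The same holds for
  \<open>U_total\<close>.\<close>

definition u_total :: "bs_params \<Rightarrow> real \<Rightarrow> real" where
  "u_total P x = Re (\<Sum>r=1..bs_d P. u_fun (bs_alpha P r) x)"

definition U_total :: "bs_params \<Rightarrow> real \<Rightarrow> real" where
  "U_total P x = Re (\<Sum>r=1..bs_d P. u_int (bs_alpha P r) x)"

lemma of_real_u_total: 
  assumes "bs_admissible P"
  shows "of_real (u_total P x) = (\<Sum>r=1..bs_d P. u_fun (bs_alpha P r) x)"
proof -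
  have "cnj (\<Sum>r=1..bs_d P. u_fun (bs_alpha P r) x) = (\<Sum>r=1..bs_d P. u_fun (bs_alpha P r) x)"
    using sum_cnj_alpha[OF assms, of "\<lambda>a. u_fun a x"] by (simp add: u_fun_cnj)
  then show ?thesis unfolding u_total_def by (intro of_real_Re) (simp only: Reals_cnj_iff)
qed

lemma of_real_U_total: 
  assumes "bs_admissible P"
  shows "of_real (U_total P x) = (\<Sum>r=1..bs_d P. u_int (bs_alpha P r) x)"
proof -
  have "cnj (\<Sum>r=1..bs_d P. u_int (bs_alpha P r) x) = (\<Sum>r=1..bs_d P. u_int (cnj (bs_alpha P r)) x)"
    using bs_admissibleD(3)[OF assms] by (simp add: u_int_cnj)
  also have "\<dots> = (\<Sum>r=1..bs_d P. u_int (bs_alpha P r) x)"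
    by (rule sum_cnj_alpha[OF assms])
  finally show ?thesis unfolding U_total_def by (intro of_real_Re) (simp only: Reals_cnj_iff)
qed

lemma u_total_nonneg: "bs_admissible P \<Longrightarrow> u_total P x \<ge> 0"
  using bs_admissibleD(3)[of P] by (auto simp: u_total_def intro!: sum_nonneg less_imp_le[OF Re_u_fun_pos])

lemma U_total_0 [simp]: "U_total P 0 = 0" and U_total_pi [simp]: "U_total P pi = real (bs_d P) * pi"
  by (simp_all add: U_total_def)

lemma U_total_deriv:
  assumes "bs_admissible P"
  shows "(U_total P has_real_derivative u_total P x) (at x within A)"
proof -
  have "((\<lambda>x. \<Sum>r=1..bs_d P. u_int (bs_alpha P r) x) has_vector_derivative
      (\<Sum>r=1..bs_d P. u_fun (bs_alpha P r) x)) (at x within A)"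
    using bs_admissibleD(3)[OF assms] by (intro derivative_intros u_int_deriv) auto
  from bounded_linear.has_vector_derivative[OF bounded_linear_Re this] show ?thesis
    unfolding U_total_def[abs_def] u_total_def[abs_def]
    by (simp add: has_real_derivative_iff_has_vector_derivative)
qed

text \<open>Twice the argument of \<open>c(\<xi>)\<close>, normalised by the value \<open>- \<pi> \<epsilon>-\<close> at 0.\<close>

definition phase :: "bs_params \<Rightarrow> real \<Rightarrow> real" where
  "phase P x = U_total P x - 2 * d_eps P * x - pi * real (eps_minus P)"

lemma phase_has_deriv:
  assumes "bs_admissible P"
  shows "(phase P has_real_derivative (u_total P x - 2 * d_eps P)) (at x within A)"
  unfolding phase_def[abs_def] by (auto intro!: derivative_eq_intros U_total_deriv[OF assms])

lemma phase_ends: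
  "phase P 0 = - pi * real (eps_minus P)" "phase P pi = pi * real (eps_plus P)"
  by (simp_all add: phase_def d_eps_def field_simps)

text \<open>This is c(x) = e^{i phase(x)} c(-x) with the denominators cleared, so that it also
  covers the poles of c.\<close>

lemma exp_phase:
  assumes "bs_admissible P"
  shows "zexp (phase P x) * num P (zexp x) * den P (cnj (zexp x)) = num P (cnj (zexp x)) * den P (zexp x)"
proof -
  define z where "z = zexp x"
  have zc: "z * cnj z = 1" by (simp add: z_def)
  have z: "z \<noteq> 0" by (simp add: z_def)
  have cz: "cmod z = 1" by (simp add: z_def)
  have "zexp (U_total P x) = (\<Prod>r=1..bs_d P. exp (\<i> * u_int (bs_alpha P r) x))"
    by (simp add: of_real_U_total[OF assms] exp_sum sum_distrib_left)
  also have "\<dots> = (\<Prod>r=1..bs_d P. z * (1 + bs_alpha P r * cnj z) / (1 + bs_alpha P r * z))"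
    using bs_admissibleD(3)[OF assms] by (intro prod.cong refl) (simp add: exp_i_u_int z_def)
  also have "\<dots> = z ^ bs_d P * num P (cnj z) / num P z"
    by (simp add: num_def prod_dividef prod.distrib)
  finally have 1: "zexp (U_total P x) * num P z = z ^ bs_d P * num P (cnj z)"
    using num_nonzero[OF assms, of z] cz by (simp add: field_simps)
  \<comment> \<open>The linear part of the phase cuts \<open>z ^ bs_d P\<close> down to one factor
    \<open>z\<close> per sign equal to 1, and the constant part supplies a sign. These are the
    factors relating \<open>den P (cnj z)\<close> to \<open>den P z\<close>.\<close>
  have 2: "z ^ bs_d P * zexp (- (2 * d_eps P * x) - pi * real (eps_minus P)) = z ^ eps_plus P * z ^ eps_minus P * (-1) ^ eps_minus P"
  proof -
    have "(-1) ^ eps_minus P = zexp (- pi * real (eps_minus P))"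
      using bs_admissibleD(2)[OF assms] by (auto simp: exp_minus)
    moreover have "z ^ k = zexp (real k * x)" for k
      by (simp add: z_def exp_of_nat_mult[symmetric] mult_ac)
    moreover have "real (bs_d P) * x + (- (2 * d_eps P * x) - pi * real (eps_minus P)) =
        real (eps_plus P) * x + real (eps_minus P) * x + (- pi * real (eps_minus P))"
      by (simp add: d_eps_def field_simps)
    moreover have "zexp a * zexp b = zexp (a + b)" for a b
      by (simp add: distrib_left exp_add)
    ultimately show ?thesis by (simp only:)
  qed
  have 3: "z ^ eps_plus P * z ^ eps_minus P * (-1) ^ eps_minus P * den P (cnj z) = den P z"
    using bs_admissibleD(1,2)[OF assms] zc by (auto simp: den_def algebra_simps)
  have "phase P x = U_total P x + (- (2 * d_eps P * x) - pi * real (eps_minus P))"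
    by (simp add: phase_def)
  then have "zexp (phase P x) = zexp (U_total P x) * zexp (- (2 * d_eps P * x) - pi * real (eps_minus P))"
    by (simp only: of_real_add distrib_left exp_add)
  then have "zexp (phase P x) * num P z * den P (cnj z) = 
     (zexp (U_total P x) * num P z) * zexp (- (2 * d_eps P * x) - pi * real (eps_minus P)) * den P (cnj z)"
    by simp
  also have "\<dots> = num P (cnj z) * (z ^ bs_d P * zexp (- (2 * d_eps P * x) - pi * real (eps_minus P))) * den P (cnj z)"
    unfolding 1 by simp
  also have "\<dots> = num P (cnj z) * den P z"
    unfolding 2 by (simp only: 3[symmetric] mult.assoc)
  finally show ?thesis by (simp add: z_def)
qed

subsection \<open>The moment functional\<close>

text \<open>Cauchy's formula gives the mean over the full circle; by the symmetry the real part is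
  even in the angle, so the upper half contributes one half.\<close>

lemma mean_value_half_circle:
  assumes hol: "H holomorphic_on cball 0 1" and sym: "\<And>x. H (cnj (zexp x)) = cnj (H (zexp x))"
  shows "((\<lambda>x. Re (H (zexp x))) has_integral pi * Re (H 0)) {0..pi}"
proof -
  define g where "g x = Re (H (zexp x))" for x
  have cont: "continuous_on A g" for A
  proof -
    have "continuous_on UNIV (\<lambda>x. H (zexp x))"
      by (rule continuous_on_compose2[OF holomorphic_on_imp_continuous_on[OF hol]])
        (auto intro!: continuous_intros)
    then show ?thesis
      unfolding g_def by (intro continuous_intros) (auto intro: continuous_on_subset)
  qed
  have "((\<lambda>u. H u / (u - 0)) has_contour_integral (2 * of_real pi * \<i> * H 0)) (circlepath 0 1)"
    by (rule Cauchy_integral_circlepath_simple[OF hol]) simp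
  then have "((\<lambda>t. H (zexp t) / zexp t * \<i> * zexp t) has_integral (2 * of_real pi * \<i> * H 0)) {0..2*pi}"
    unfolding circlepath_def by (subst (asm) has_contour_integral_part_circlepath_iff) (auto simp: cis_conv_exp)
  \<comment> \<open>The factors \<open>zexp t\<close> cancel, and
    \<open>Im (\<i> * w) = Re w\<close>.\<close>
  then have "((\<lambda>t. Im (\<i> * H (zexp t))) has_integral Im (2 * of_real pi * \<i> * H 0)) {0..2*pi}"
    by (intro has_integral_Im) (simp add: mult_ac)
  then have full: "(g has_integral 2 * pi * Re (H 0)) {0..2*pi}"
    by (simp add: g_def[abs_def])
  have half: "(g has_integral integral {0..pi} g) {0..pi}" "(g has_integral integral {pi..2*pi} g) {pi..2*pi}"
    using integrable_continuous_real[OF cont] by (auto intro: integrable_integral)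
  have "(g has_integral integral {0..pi} g + integral {pi..2*pi} g) {0..2*pi}"
    by (rule has_integral_combine[OF _ _ half]) auto
  with full have sum: "integral {0..pi} g + integral {pi..2*pi} g = 2 * pi * Re (H 0)"
    by (rule has_integral_unique[rotated])
  have refl: "g (2 * pi - x) = g x" for x
  proof -
    have "zexp (2 * pi - x) = cnj (zexp x)"
      by (simp add: right_diff_distrib exp_diff exp_cnj exp_minus divide_inverse mult_ac exp_two_pi_i')
    then show ?thesis by (simp add: g_def sym)
  qed
  have img: "(\<lambda>x::real. - x + 2 * pi) ` {pi..2*pi} = {0..pi}"
  proof
    show "{0..pi} \<subseteq> (\<lambda>x::real. - x + 2 * pi) ` {pi..2*pi}"
    proof
      fix x :: real assume "x \<in> {0..pi}"
      then show "x \<in> (\<lambda>x::real. - x + 2 * pi) ` {pi..2*pi}"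
        by (intro image_eqI[where x = "2 * pi - x"]) auto
    qed
  qed auto
  have "((\<lambda>x. g (- x + 2 * pi)) has_integral integral {pi..2*pi} g) {0..pi}"
    using has_integral_affinity[of g "integral {pi..2*pi} g" pi "2*pi" "-1" "2*pi"] half(2) img by simp
  then have "(g has_integral integral {pi..2*pi} g) {0..pi}"
    using refl by (simp add: add.commute)
  then have "integral {pi..2*pi} g = integral {0..pi} g"
    using half(1) has_integral_unique by blast
  with sum have "integral {0..pi} g = pi * Re (H 0)" by simp
  with half(1) show ?thesis by (simp add: g_def[abs_def])
qed

text \<open>On the unit circle 1 + z = z (1 + cnj z) and 1 - z = -z (1 - cnj z).\<close>

lemma den_times_cnj: "bs_admissible P \<Longrightarrow> z * cnj z = 1 \<Longrightarrow>
   den P z = z ^ (eps_plus P + eps_minus P) * (- 1) ^ eps_minus P * den P (cnj z)"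
  using bs_admissibleD(1,2)[of P] by (auto simp: den_def algebra_simps)

lemma bs_weight_cnj:
  assumes P: "bs_admissible P"
  shows "of_real (bs_weight P x) = den P (zexp x) * den P (cnj (zexp x)) / (2 * pi * num P (zexp x) * num P (cnj (zexp x)))"
proof -
  have "(of_real (cmod (den P z)))\<^sup>2 = den P z * den P (cnj z)"
    "(of_real (cmod (num P z)))\<^sup>2 = num P z * num P (cnj z)" for z
    using complex_norm_square[of "den P z"] complex_norm_square[of "num P z"]
    by (simp_all add: num_cnj[OF P] den_cnj)
  then show ?thesis unfolding bs_weight_eq[OF P] by (simp add: mult_ac)
qed

lemma bs_weight_nonneg: "bs_weight P x \<ge> 0"
  by (simp add: bs_weight_def)

lemma den_eq_0_iff:
  assumes P: "bs_admissible P" and x: "x \<in> {0..pi}"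
  shows "den P (zexp x) = 0 \<longleftrightarrow> eps_minus P = 1 \<and> x = 0 \<or> eps_plus P = 1 \<and> x = pi"
proof -
  have "zexp x = 1 \<longleftrightarrow> x = 0"
  proof
    assume "zexp x = 1"
    then have "cos x = cos 0" by (simp add: complex_eq_iff Re_exp)
    then show "x = 0" using x cos_inj_pi[of x 0] by simp
  qed simp
  moreover have "1 + zexp x = 0 \<longleftrightarrow> x = pi"
  proof
    assume "1 + zexp x = 0"
    then have "cos x = cos pi" by (simp add: complex_eq_iff Re_exp)
    then show "x = pi" using x cos_inj_pi[of x pi] by simp
  qed simp
  ultimately show ?thesis
    using bs_admissibleD(1,2)[OF P] by (auto simp: den_def)
qed

lemma continuous_bs_weight:
  assumes "bs_admissible P" shows "continuous_on A (bs_weight P)"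
proof -
  have "continuous_on A (\<lambda>x. (cmod (den P (zexp x)))\<^sup>2 / (2 * pi * (cmod (num P (zexp x)))\<^sup>2))"
    using num_nonzero[OF assms, of "zexp _"]
    by (intro continuous_intros) (auto simp: num_def den_def intro!: continuous_intros)
  then show ?thesis using bs_weight_eq[OF assms] by (simp cong: continuous_on_cong)
qed

text \<open>The variable is e^{ix} + e^{-ix}, in which the cosine basis consists of monic
  polynomials.\<close>

definition poly_fun :: "real poly \<Rightarrow> real \<Rightarrow> real" where
  "poly_fun f x = poly f (2 * cos x)"

definition moment :: "bs_params \<Rightarrow> real poly \<Rightarrow> real" where
  "moment P f = integral {0..pi} (\<lambda>x. poly_fun f x * bs_weight P x)"

lemma continuous_poly_fun: "continuous_on A (poly_fun f)"
  unfolding poly_fun_def[abs_def] by (intro continuous_intros)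

lemma bs_inner_poly_fun:
  assumes "bs_admissible P"
  shows "bs_inner P (poly_fun f) (poly_fun g) = moment P (f * g)"
proof -
  have "continuous_on {0..pi} (\<lambda>x. poly_fun f x * poly_fun g x * bs_weight P x)"
    by (intro continuous_intros continuous_poly_fun continuous_bs_weight assms)
  from interval_integral_eq_integral[OF _ borel_integrable_atLeastAtMost'[OF this]]
  show ?thesis
    unfolding bs_inner_def moment_def by (simp add: poly_fun_def zero_ereal_def)
qed

lemma moment_integrable:
  assumes "bs_admissible P"
  shows "(\<lambda>x. poly_fun f x * bs_weight P x) integrable_on {0..pi}"
  by (intro integrable_continuous_real continuous_intros continuous_poly_fun continuous_bs_weight assms)

lemma moment_add:
  assumes "bs_admissible P" shows "moment P (f + g) = moment P f + moment P g"
  unfolding moment_def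
  by (subst integral_add[symmetric, OF moment_integrable moment_integrable])
    (auto simp: poly_fun_def distrib_right assms)

lemma moment_smult: "moment P (smult c f) = c * moment P f"
  unfolding moment_def by (simp add: poly_fun_def mult.assoc)

text \<open>\<open>2 * cos x\<close> takes infinitely many values on the open interval.\<close>

lemma poly_fun_eq_0:
  assumes "\<And>x. 0 < x \<Longrightarrow> x < pi \<Longrightarrow> poly_fun f x = 0" shows "f = 0"
proof (rule ccontr)
  assume "f \<noteq> 0"
  have "inj_on (\<lambda>x. 2 * cos x) {0<..<pi}"
  proof (rule inj_onI)
    fix x y assume "x \<in> {0<..<pi}" "y \<in> {0<..<pi}" "2 * cos x = 2 * cos y"
    then show "x = y" using cos_inj_pi[of x y] by simp
  qed
  then have "infinite ((\<lambda>x. 2 * cos x) ` {0<..<pi})"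
    using finite_imageD infinite_Ioo[of 0 pi] by fastforce
  moreover have "(\<lambda>x. 2 * cos x) ` {0<..<pi} \<subseteq> {y. poly f y = 0}"
    using assms by (auto simp: poly_fun_def)
  ultimately show False
    using poly_roots_finite[OF \<open>f \<noteq> 0\<close>] finite_subset by blast
qed

text \<open>The weight is continuous and can vanish only at the endpoints, so a zero integral forces
  \<open>f\<close> to vanish on the whole interior.\<close>

lemma moment_pos:
  assumes P: "bs_admissible P" and f: "f \<noteq> 0" shows "moment P (f * f) > 0"
proof -
  let ?g = "\<lambda>x. poly_fun (f * f) x * bs_weight P x"
  have nonneg: "?g x \<ge> 0" for x
    by (simp add: poly_fun_def bs_weight_nonneg)
  have "moment P (f * f) \<noteq> 0"
  proof
    assume "moment P (f * f) = 0"
    then have "integral {0..pi} ?g = 0" by (simp add: moment_def)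
    moreover have "continuous_on {0..pi} ?g"
      by (intro continuous_intros continuous_poly_fun continuous_bs_weight P)
    ultimately have zero: "?g x = 0" if "x \<in> {0..pi}" for x
      using integral_eq_0_iff[of 0 pi ?g] nonneg that pi_gt_zero by blast
    have "poly_fun f x = 0" if x: "0 < x" "x < pi" for x
    proof -
      have "den P (zexp x) \<noteq> 0" using den_eq_0_iff[OF P, of x] x by auto
      moreover have "num P (zexp x) \<noteq> 0" by (rule num_nonzero[OF P]) simp
      ultimately have "bs_weight P x \<noteq> 0" by (simp add: bs_weight_eq[OF P])
      with zero[of x] x show ?thesis by (simp add: poly_fun_def)
    qed
    then show False using f poly_fun_eq_0 by blast
  qed
  moreover have "moment P (f * f) \<ge> 0"
    unfolding moment_def by (rule integral_nonneg) (use nonneg moment_integrable[OF P] in auto)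
  ultimately show ?thesis by simp
qed

section \<open>Chebyshev recurrences\<close>

text \<open>The Chebyshev recurrence in the variable 2 cos x, with free initial values
  \<open>c\<close> and \<open>b + y\<close>; 2 cos(kx) has \<open>c = 2\<close>,
  \<open>b = 0\<close>, which is why \<open>cheb_coeff_eq\<close> leaves out degree 0.\<close>

fun cheb :: "real \<Rightarrow> real \<Rightarrow> nat \<Rightarrow> real poly" where
  "cheb c b 0 = [:c:]"
| "cheb c b (Suc 0) = [:b, 1:]"
| "cheb c b (Suc (Suc k)) = pCons 0 (cheb c b (Suc k)) - cheb c b k"

lemma cheb_coeff_gt: "k < i \<Longrightarrow> coeff (cheb c b k) i = 0"
  by (induction c b k arbitrary: i rule: cheb.induct) (auto simp: coeff_pCons split: nat.splits)

lemma cheb_coeff_eq: "k > 0 \<Longrightarrow> coeff (cheb c b k) k = 1"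
  by (induction c b k rule: cheb.induct) (auto simp: coeff_pCons cheb_coeff_gt split: nat.splits)

lemma cheb_eval:
  assumes "s 0 = c" "s (Suc 0) = b + y" "\<And>k. s (Suc (Suc k)) = y * s (Suc k) - s k"
  shows "poly (cheb c b k) y = s k"
  using assms by (induction c b k rule: cheb.induct) auto

definition cos_poly :: "nat \<Rightarrow> real poly" where
  "cos_poly l = (if l = 0 then 1 else cheb 2 0 l)"

lemma cos_poly_coeff_gt: "l < i \<Longrightarrow> coeff (cos_poly l) i = 0"
  and cos_poly_coeff_eq: "coeff (cos_poly l) l = 1"
  using cheb_coeff_gt[of l i] cheb_coeff_eq[of l] by (auto simp: cos_poly_def)

lemma cos_basis_eq_poly_fun: "cos_basis l = poly_fun (cos_poly l)"
proof
  fix x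
  have "poly (cheb 2 0 l) (2 * cos x) = 2 * cos (real l * x)"
  proof (rule cheb_eval[where s = "\<lambda>l. 2 * cos (real l * x)"])
    fix k
    have "real (Suc (Suc k)) * x = real (Suc k) * x + x" "real k * x = real (Suc k) * x - x"
      by (auto simp: algebra_simps)
    then show "2 * cos (real (Suc (Suc k)) * x) = 2 * cos x * (2 * cos (real (Suc k) * x)) - 2 * cos (real k * x)"
      by (simp only: cos_add cos_diff) (simp add: algebra_simps)
  qed auto
  then show "cos_basis l x = poly_fun (cos_poly l) x"
    by (simp add: cos_basis_def poly_fun_def cos_poly_def)
qed

section \<open>Gram-Schmidt functions as orthogonal polynomials\<close>

lemma bs_p_poly:
  "\<exists>f. (\<forall>i>l. coeff f i = 0) \<and> coeff f l = 1 \<and> bs_p P l = poly_fun f"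
proof (induction l rule: less_induct)
  case (less l)
  then obtain g where g: "\<And>k. k < l \<Longrightarrow> (\<forall>i>k. coeff (g k) i = 0) \<and> bs_p P k = poly_fun (g k)"
    by metis
  let ?c = "\<lambda>k. bs_inner P (cos_basis l) (bs_p P k) / bs_inner P (bs_p P k) (bs_p P k)"
  define f where "f = cos_poly l - (\<Sum>k<l. smult (?c k) (g k))"
  have "coeff f i = coeff (cos_poly l) i" if "l \<le> i" for i
    using that g by (simp add: f_def coeff_sum)
  moreover have "bs_p P l = poly_fun f"
    using g by (subst bs_p.simps) (simp add: fun_eq_iff cos_basis_eq_poly_fun f_def poly_fun_def poly_sum)
  ultimately show ?case
    using cos_poly_coeff_gt[of l] cos_poly_coeff_eq[of l] by (intro exI[of _ f]) auto
qed

definition bs_poly :: "bs_params \<Rightarrow> nat \<Rightarrow> real poly" where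
  "bs_poly P l = (SOME f. (\<forall>i>l. coeff f i = 0) \<and> coeff f l = 1 \<and> bs_p P l = poly_fun f)"

lemma bs_poly:
  "l < i \<Longrightarrow> coeff (bs_poly P l) i = 0" "coeff (bs_poly P l) l = 1" "bs_p P l = poly_fun (bs_poly P l)"
  using someI_ex[OF bs_p_poly[of l P]] unfolding bs_poly_def by blast+

lemma moment_sum: "bs_admissible P \<Longrightarrow> moment P (\<Sum>i\<in>A. f i) = (\<Sum>i\<in>A. moment P (f i))"
  by (induction A rule: infinite_finite_induct) (simp_all add: moment_add moment_smult[of P 0 0, simplified])

lemma poly_fun_eq_iff: "poly_fun f = poly_fun g \<longleftrightarrow> f = g"
  using poly_fun_eq_0[of "f - g"] by (auto simp: fun_eq_iff poly_fun_def)

lemma bs_poly_rec: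
  assumes P: "bs_admissible P"
  shows "bs_poly P l = cos_poly l - (\<Sum>k<l. smult (moment P (cos_poly l * bs_poly P k) / moment P (bs_poly P k * bs_poly P k)) (bs_poly P k))"
    (is "_ = ?f")
proof -
  have "poly_fun (bs_poly P l) = poly_fun ?f"
    by (subst bs_poly(3)[symmetric], subst bs_p.simps)
      (simp add: fun_eq_iff bs_poly(3) cos_basis_eq_poly_fun bs_inner_poly_fun[OF P], simp add: poly_fun_def poly_sum)
  then show ?thesis by (simp add: poly_fun_eq_iff)
qed

lemma bs_poly_orth:
  assumes P: "bs_admissible P"
  shows "k < l \<Longrightarrow> moment P (bs_poly P l * bs_poly P k) = 0"
proof (induction l arbitrary: k rule: less_induct)
  case (less l j)
  let ?p = "bs_poly P"
  have nz: "?p k \<noteq> 0" for k using bs_poly(2)[of P k] by auto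
  have pos: "moment P (?p k * ?p k) \<noteq> 0" for k using moment_pos[OF P nz[of k]] by simp
  \<comment> \<open>Both indices are below \<open>l\<close>, so the induction hypothesis for the
    larger of them applies, in either order. Only the term \<open>k = j\<close> of the Gram-Schmidt
    sum survives.\<close>
  have orth: "moment P (?p k * ?p j) = 0" if "k < l" "k \<noteq> j" for k
    using less.IH[of k j] less.IH[of j k] less.prems that by (cases k j rule: linorder_cases) (auto simp: mult.commute)
  have "moment P (cos_poly l * ?p j) = moment P (?p l * ?p j + (\<Sum>k<l. smult (moment P (cos_poly l * ?p k) / moment P (?p k * ?p k)) (?p k)) * ?p j)"
    by (subst bs_poly_rec[OF P, of l]) (simp flip: distrib_right)
  also have "\<dots> = moment P (?p l * ?p j) + (\<Sum>k<l. moment P (cos_poly l * ?p k) / moment P (?p k * ?p k) * moment P (?p k * ?p j))"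
    by (simp add: moment_add[OF P] sum_distrib_right moment_sum[OF P] moment_smult)
  also have "(\<Sum>k<l. moment P (cos_poly l * ?p k) / moment P (?p k * ?p k) * moment P (?p k * ?p j)) =
     (\<Sum>k<l. if k = j then moment P (cos_poly l * ?p j) else 0)"
    using pos[of j] by (intro sum.cong) (simp_all add: orth)
  also have "\<dots> = moment P (cos_poly l * ?p j)" using less.prems by simp
  finally show ?case by simp
qed

lemma monic_orthogonal_bs_poly:
  assumes P: "bs_admissible P" shows "monic_orthogonal (moment P) (bs_poly P)"
  by unfold_locales (use moment_add[OF P] moment_smult moment_pos[OF P] bs_poly bs_poly_orth[OF P] in auto)

subsection \<open>Explicit polynomials of large degree\<close>

definition num_coeff :: "bs_params \<Rightarrow> nat \<Rightarrow> complex" where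
  "num_coeff P = coeff (\<Prod>r=1..bs_d P. [:1, bs_alpha P r:])"

lemma num_eq_sum: "num P z = (\<Sum>r\<le>bs_d P. num_coeff P r * z ^ r)"
proof -
  let ?p = "\<Prod>r=1..bs_d P. [:1, bs_alpha P r:]"
  have "degree ?p \<le> (\<Sum>r=1..bs_d P. degree [:1, bs_alpha P r:])"
    by (rule degree_prod_sum_le[unfolded comp_def]) simp
  also have "\<dots> \<le> (\<Sum>r=1..bs_d P. 1)"
    by (rule sum_mono) simp
  finally have "degree ?p \<le> bs_d P" by simp
  have "num P z = poly ?p z"
    by (simp add: num_def poly_prod mult.commute)
  also have "\<dots> = (\<Sum>r\<le>degree ?p. coeff ?p r * z ^ r)"
    by (rule poly_altdef)
  also have "\<dots> = (\<Sum>r\<le>bs_d P. coeff ?p r * z ^ r)"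
    using \<open>degree ?p \<le> bs_d P\<close> by (intro sum.mono_neutral_left) (auto simp: coeff_eq_0)
  finally show ?thesis by (simp add: num_coeff_def)
qed

lemma num_coeff_0: "num_coeff P 0 = 1"
  by (simp add: num_coeff_def flip: poly_0_coeff_0) (simp add: poly_prod)

lemma coeff_prod_cnj:
  "finite A \<Longrightarrow> coeff (\<Prod>r\<in>A. [:1, cnj (a r):]) i = cnj (coeff (\<Prod>r\<in>A. [:1, a r:]) i)"
  by (induction A arbitrary: i rule: finite_induct) (auto simp: coeff_pCons split: nat.splits)

lemma num_coeff_real:
  assumes "bs_admissible P" shows "of_real (Re (num_coeff P r)) = num_coeff P r"
  using coeff_prod_cnj[of "{1..bs_d P}" "bs_alpha P" r]
    prod_cnj_alpha[OF assms, of "\<lambda>a. [:1, a:]"]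
  by (intro of_real_Re) (simp add: num_coeff_def Reals_cnj_iff)

text \<open>This is \<open>c(\<xi>) e^{il\<xi>} + c(-\<xi>) e^{-il\<xi>}\<close>.\<close>

definition bs_q :: "bs_params \<Rightarrow> nat \<Rightarrow> real \<Rightarrow> real" where
  "bs_q P l x = 2 * Re (cnj (zexp (real l * x)) * num P (zexp x) / den P (zexp x))"

text \<open>The building block of \<open>bs_q\<close> with \<open>num\<close> replaced by 1.
  Expanding \<open>num\<close> shifts the index from \<open>l\<close> to \<open>l - r\<close>, which
  may be negative, hence the type \<open>int\<close>.\<close>

definition chi :: "bs_params \<Rightarrow> int \<Rightarrow> real \<Rightarrow> real" where
  "chi P k x = 2 * Re (cnj (zexp (of_int k * x)) / den P (zexp x))"

lemma zexp_power: "zexp x ^ k = zexp (real k * x)"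
  by (simp add: exp_of_nat_mult[symmetric] mult_ac)

lemma zexp_add: "zexp (x + y) = zexp x * zexp y"
  by (simp add: distrib_left exp_add)

lemma zexp_minus: "zexp (- x) = cnj (zexp x)"
  by (simp add: exp_cnj)

lemma Re_of_real_mult: "Re (of_real a * w) = a * Re w"
  by simp

lemma bs_q_eq_sum:
  assumes "bs_admissible P"
  shows "bs_q P l x = (\<Sum>r\<le>bs_d P. Re (num_coeff P r) * chi P (int l - int r) x)"
proof -
  have *: "cnj (zexp (real l * x)) * zexp x ^ r = cnj (zexp (of_int (int l - int r) * x))" for r
  proof -
    have "of_int (int l - int r) * x = real l * x + - (real r * x)"
      by (simp add: algebra_simps)
    then show ?thesis
      unfolding zexp_power by (simp only: zexp_add zexp_minus complex_cnj_mult complex_cnj_cnj)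
  qed
  have "cnj (zexp (real l * x)) * num P (zexp x) / den P (zexp x) =
     (\<Sum>r\<le>bs_d P. num_coeff P r * (cnj (zexp (real l * x)) * zexp x ^ r / den P (zexp x)))"
    by (simp add: num_eq_sum sum_distrib_left sum_divide_distrib mult_ac)
  also have "\<dots> = (\<Sum>r\<le>bs_d P. of_real (Re (num_coeff P r)) * (cnj (zexp (of_int (int l - int r) * x)) / den P (zexp x)))"
    unfolding * by (simp only: num_coeff_real[OF assms])
  finally show ?thesis
    unfolding bs_q_def chi_def by (simp only: Re_sum Re_of_real_mult sum_distrib_left mult.left_commute)
qed

lemma chi_rec: "chi P (k + 1) x = 2 * cos x * chi P k x - chi P (k - 1) x"
proof -
  have k: "of_int (k + 1) * x = of_int k * x + x" "of_int (k - 1) * x = of_int k * x + - x"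
    by (auto simp: algebra_simps)
  have c: "cnj (zexp x) + zexp x = of_real (2 * cos x)"
    by (simp add: complex_eq_iff Re_exp Im_exp)
  have "cnj (zexp (of_int (k + 1) * x)) + cnj (zexp (of_int (k - 1) * x)) = cnj (zexp (of_int k * x)) * (cnj (zexp x) + zexp x)"
    unfolding k zexp_add zexp_minus by (simp add: algebra_simps)
  then have "cnj (zexp (of_int (k + 1) * x)) / den P (zexp x) + cnj (zexp (of_int (k - 1) * x)) / den P (zexp x) =
     of_real (2 * cos x) * (cnj (zexp (of_int k * x)) / den P (zexp x))"
    unfolding c by (simp only: add_divide_distrib[symmetric] times_divide_eq_right mult.commute)
  from arg_cong[OF this, of Re] show ?thesis
    unfolding chi_def plus_complex.sel Re_of_real_mult by (simp only: mult.left_commute[of 2])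
qed

text \<open>By \<open>den_times_cnj\<close> the reflected quotient is, up to sign, the complex
  conjugate of the original one. This folds negative indices back to nonnegative ones.\<close>

lemma chi_reflect:
  assumes P: "bs_admissible P"
  shows "chi P (- int (eps_plus P + eps_minus P) - k) x = (- 1) ^ eps_minus P * chi P k x"
proof -
  let ?z = "zexp x" and ?e = "eps_plus P + eps_minus P"
  have "of_int (- int ?e - k) * x = - (real ?e * x) + - (of_int k * x)"
    by (simp add: algebra_simps)
  then have "cnj (zexp (of_int (- int ?e - k) * x)) = ?z ^ ?e * zexp (of_int k * x)"
    by (simp only: zexp_add zexp_minus zexp_power complex_cnj_mult complex_cnj_cnj)
  moreover have "den P ?z = ?z ^ ?e * (- 1) ^ eps_minus P * cnj (den P ?z)"
    unfolding den_cnj by (rule den_times_cnj[OF P]) simp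
  ultimately have "cnj (zexp (of_int (- int ?e - k) * x)) / den P ?z = 
      (?z ^ ?e * zexp (of_int k * x)) / (?z ^ ?e * (- 1) ^ eps_minus P * cnj (den P ?z))"
    by metis
  also have "\<dots> = (- 1) ^ eps_minus P * cnj (cnj (zexp (of_int k * x)) / den P ?z)"
    using bs_admissibleD(2)[OF P] by auto
  finally have "cnj (zexp (of_int (- int ?e - k) * x)) / den P ?z =
      of_real ((- 1) ^ eps_minus P) * cnj (cnj (zexp (of_int k * x)) / den P ?z)"
    by simp
  then show ?thesis
    unfolding chi_def by (simp only: Re_of_real_mult cnj.sel mult.left_commute)
qed

text \<open>Inversion sends the circle of radius 1 around 1 to a vertical line.\<close>

lemma Re_inverse_one_minus:
  assumes "cmod w = 1" "w \<noteq> 1" shows "Re (1 / (1 - w)) = 1 / 2"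
proof -
  have "(Re w)\<^sup>2 + (Im w)\<^sup>2 = 1" using assms by (simp add: cmod_power2[symmetric])
  moreover from this have "Re w \<noteq> 1" using assms(2) by (auto simp: complex_eq_iff)
  ultimately show ?thesis
    by (simp add: Re_divide divide_simps) (simp add: power2_eq_square algebra_simps)
qed

text \<open>When a sign is present, splitting \<open>cnj ?z\<close> off
  \<open>cnj ?z / den P ?z\<close> leaves a term of constant real part: 1/2 up to sign for a single
  sign, 0 for both.\<close>

lemma chi_initial:
  assumes P: "bs_admissible P" and nz: "den P (zexp x) \<noteq> 0"
  shows "chi P 0 x = (if eps_plus P + eps_minus P = 0 then 2 else 1)"
    and "chi P 1 x = real (eps_minus P) - real (eps_plus P) + 2 * cos x"
proof -
  let ?z = "zexp x"
  have zz: "?z * cnj ?z = 1" by simp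
  have c: "Re ?z = cos x" "Re (cnj ?z) = cos x" by (simp_all add: Re_exp)
  consider (none) "eps_plus P = 0" "eps_minus P = 0" | (plus) "eps_plus P = 1" "eps_minus P = 0"
    | (minus) "eps_plus P = 0" "eps_minus P = 1" | (both) "eps_plus P = 1" "eps_minus P = 1"
    using bs_admissibleD(1,2)[OF P] by metis
  then have "chi P 0 x = (if eps_plus P + eps_minus P = 0 then 2 else 1) \<and>
     chi P 1 x = real (eps_minus P) - real (eps_plus P) + 2 * cos x"
  proof cases
    case none
    then show ?thesis using c by (simp add: chi_def den_def)
  next
    case plus
    then have d: "den P ?z = 1 - (- ?z)" and "1 + ?z \<noteq> 0" using nz by (auto simp: den_def)
    then have "cnj ?z / den P ?z = cnj ?z - 1 / (1 - (- ?z))"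
      using zz by (simp add: field_simps)
    moreover have "Re (1 / (1 - (- ?z))) = 1 / 2"
    proof (rule Re_inverse_one_minus)
      show "- ?z \<noteq> 1"
        using \<open>1 + ?z \<noteq> 0\<close> by (metis add.inverse_inverse add.right_inverse)
    qed simp
    ultimately show ?thesis using plus c d by (simp add: chi_def)
  next
    case minus
    then have d: "den P ?z = 1 - ?z" and "1 - ?z \<noteq> 0" using nz by (auto simp: den_def)
    then have "cnj ?z / den P ?z = cnj ?z + 1 / (1 - ?z)"
      using zz by (simp add: field_simps)
    moreover have "Re (1 / (1 - ?z)) = 1 / 2"
      using \<open>1 - ?z \<noteq> 0\<close> by (intro Re_inverse_one_minus) auto
    ultimately show ?thesis using minus c d by (simp add: chi_def)
  next
    case both
    then have d: "den P ?z = 1 - ?z * ?z" and n: "1 - ?z * ?z \<noteq> 0" using nz by (auto simp: den_def algebra_simps)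
    then have "cnj ?z / den P ?z = cnj ?z + ?z / (1 - ?z * ?z)"
      using zz by (simp add: field_simps)
    moreover have "Re (?z / (1 - ?z * ?z)) = 0"
    proof -
      have "?z / (1 - ?z * ?z) = ?z / (?z * (cnj ?z - ?z))"
        using zz by (simp add: algebra_simps)
      also have "\<dots> = 1 / (cnj ?z - ?z)" by simp
      finally show ?thesis by (simp add: Re_divide)
    qed
    moreover have "Re (1 / (1 - ?z * ?z)) = 1 / 2"
      using n by (intro Re_inverse_one_minus) (auto simp: norm_mult)
    ultimately show ?thesis using both c d by (simp add: chi_def)
  qed
  then show "chi P 0 x = (if eps_plus P + eps_minus P = 0 then 2 else 1)"
    and "chi P 1 x = real (eps_minus P) - real (eps_plus P) + 2 * cos x" by blast+
qed

text \<open>The four kinds of Chebyshev polynomials: twice the first kind if both signs are 0, the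
  third for \<open>eps_plus\<close> alone, the fourth for \<open>eps_minus\<close> alone, the second
  for both.\<close>

definition chi_poly :: "bs_params \<Rightarrow> nat \<Rightarrow> real poly" where
  "chi_poly P = cheb (if eps_plus P + eps_minus P = 0 then 2 else 1) (real (eps_minus P) - real (eps_plus P))"

lemma chi_poly_eval:
  assumes P: "bs_admissible P" and nz: "den P (zexp x) \<noteq> 0"
  shows "poly_fun (chi_poly P k) x = chi P (int k) x"
  unfolding chi_poly_def poly_fun_def
proof (rule cheb_eval[where s = "\<lambda>k. chi P (int k) x"])
  show "chi P (int (Suc (Suc k))) x = 2 * cos x * chi P (int (Suc k)) x - chi P (int k) x" for k
    using chi_rec[of P "int (Suc k)" x] by (simp add: add.commute)
qed (use chi_initial[OF P nz] in simp_all)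

text \<open>Comes from \<open>bs_q_eq_sum\<close> by folding the indices \<open>l - r\<close> with
  \<open>chi_reflect\<close>. The zero branch is reached only for \<open>r = l + 1\<close> with both
  signs 1, where the reflection makes \<open>chi P (- 1) x\<close> its own negative.\<close>

definition bs_q_poly :: "bs_params \<Rightarrow> nat \<Rightarrow> real poly" where
  "bs_q_poly P l = (\<Sum>r\<le>bs_d P. smult (Re (num_coeff P r))
     (if r \<le> l then chi_poly P (l - r)
      else if r < l + eps_plus P + eps_minus P then 0
      else smult ((- 1) ^ eps_minus P) (chi_poly P (r - l - (eps_plus P + eps_minus P)))))"

lemma bs_q_poly_eval:
  assumes P: "bs_admissible P" and nz: "den P (zexp x) \<noteq> 0"
  shows "poly_fun (bs_q_poly P l) x = bs_q P l x"
proof -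
  let ?e = "eps_plus P + eps_minus P"
  have "poly_fun (if r \<le> l then chi_poly P (l - r)
      else if r < l + eps_plus P + eps_minus P then 0
      else smult ((- 1) ^ eps_minus P) (chi_poly P (r - l - ?e))) x = chi P (int l - int r) x" for r
  proof -
    consider "r \<le> l" | "l < r" "r < l + ?e" | "l < r" "l + ?e \<le> r" by linarith
    then show ?thesis
    proof cases
      case 1
      then show ?thesis using chi_poly_eval[OF P nz, of "l - r"] by (simp add: of_nat_diff)
    next
      case 2
      then have "eps_plus P = 1" "eps_minus P = 1" "r = Suc l" using bs_admissibleD(1,2)[OF P] by auto
      then have "chi P (- 1) x = - chi P (- 1) x" using chi_reflect[OF P, of "- 1" x] by simp
      then show ?thesis using 2 \<open>r = Suc l\<close> by (simp add: poly_fun_def)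
    next
      case 3
      then have "chi P (int l - int r) x = (- 1) ^ eps_minus P * chi P (int (r - l - ?e)) x"
        using chi_reflect[OF P, of "int (r - l - ?e)" x] by (simp add: of_nat_diff)
      then show ?thesis using 3 chi_poly_eval[OF P nz, of "r - l - ?e"] by (simp add: poly_fun_def)
    qed
  qed
  then show ?thesis
    unfolding bs_q_poly_def bs_q_eq_sum[OF P]
    by (simp add: poly_fun_def poly_sum)
qed

text \<open>The bound on \<open>l\<close> says that the folded index \<open>r - l - ?e\<close> never
  exceeds \<open>l\<close>. Under the strict bound it stays below \<open>l\<close>, and only
  \<open>r = 0\<close> contributes in degree \<open>l\<close>.\<close>

lemma bs_q_poly_coeff:
  assumes P: "bs_admissible P" and l: "real l \<ge> d_eps P"
  shows "l < i \<Longrightarrow> coeff (bs_q_poly P l) i = 0"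
    and "real l > d_eps P \<Longrightarrow> coeff (bs_q_poly P l) l = 1"
proof -
  let ?e = "eps_plus P + eps_minus P"
  have l': "2 * real l \<ge> real (bs_d P) - real ?e" using l by (simp add: d_eps_def)
  show "coeff (bs_q_poly P l) i = 0" if "l < i"
    unfolding bs_q_poly_def coeff_sum
  proof (intro sum.neutral ballI)
    fix r assume "r \<in> {..bs_d P}"
    then have "r - l - ?e < i" "l - r < i" using l' that by auto
    then show "coeff (smult (Re (num_coeff P r)) (if r \<le> l then chi_poly P (l - r)
      else if r < l + eps_plus P + eps_minus P then 0
      else smult ((- 1) ^ eps_minus P) (chi_poly P (r - l - ?e)))) i = 0"
      by (simp add: chi_poly_def cheb_coeff_gt)
  qed
  show "coeff (bs_q_poly P l) l = 1" if "real l > d_eps P"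
  proof -
    have l': "2 * real l > real (bs_d P) - real ?e" using that by (simp add: d_eps_def)
    have "coeff (chi_poly P l) l = 1"
    proof (cases "l = 0")
      case True
      \<comment> \<open>The strict bound at \<open>l = 0\<close> forces a nonzero sign, so the
        initial value of the recurrence is 1 and not 2.\<close>
      then have "?e \<noteq> 0" using l' by auto
      then show ?thesis using True by (simp add: chi_poly_def)
    qed (simp add: chi_poly_def cheb_coeff_eq)
    have "coeff (bs_q_poly P l) l = (\<Sum>r\<le>bs_d P. if r = 0 then 1 else 0)"
      unfolding bs_q_poly_def coeff_sum
    proof (intro sum.cong refl)
      fix r assume r: "r \<in> {..bs_d P}"
      show "coeff (smult (Re (num_coeff P r)) (if r \<le> l then chi_poly P (l - r)
        else if r < l + eps_plus P + eps_minus P then 0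
        else smult ((- 1) ^ eps_minus P) (chi_poly P (r - l - ?e)))) l = (if r = 0 then 1 else 0)"
      proof (cases "r = 0")
        case True
        then show ?thesis using \<open>coeff (chi_poly P l) l = 1\<close> by (simp add: num_coeff_0)
      next
        case False
        consider "r \<le> l" "l - r < l" | "l < r" "r < l + ?e" | "l < r" "l + ?e \<le> r" "r - l - ?e < l"
          using r l' False by fastforce
        then show ?thesis using False
          by cases (simp_all add: chi_poly_def cheb_coeff_gt)
      qed
    qed
    then show ?thesis by simp
  qed
qed

text \<open>The weight is a multiple of 1 / (c(x) c(-x)), so one factor c cancels; the other leaves
  the real part of a function holomorphic on the closed disc. At the zeros of \<open>den\<close>
  both sides vanish.\<close>

lemma bs_q_poly_weight:
  assumes P: "bs_admissible P" and x: "x \<in> {0..pi}"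
  shows "poly_fun (bs_q_poly P l) x * bs_weight P x = Re (zexp x ^ l * den P (zexp x) / num P (zexp x)) / pi"
proof (cases "den P (zexp x) = 0")
  case True
  then show ?thesis by (simp add: bs_weight_eq[OF P])
next
  case False
  let ?z = "zexp x"
  have n: "num P ?z \<noteq> 0" "cnj (num P ?z) \<noteq> 0" using num_nonzero[OF P, of ?z] by simp_all
  have "of_real (bs_weight P x) * (cnj (?z ^ l) * num P ?z / den P ?z)
      = cnj (?z ^ l * den P ?z / num P ?z) / of_real (2 * pi)"
    using False n by (simp add: bs_weight_cnj[OF P] num_cnj[OF P] den_cnj field_simps)
  from arg_cong[OF this, of Re]
  have "bs_weight P x * Re (cnj (?z ^ l) * num P ?z / den P ?z) = Re (?z ^ l * den P ?z / num P ?z) / (2 * pi)"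
    by (simp only: Re_of_real_mult Re_divide_of_real cnj.sel)
  then show ?thesis
    unfolding bs_q_poly_eval[OF P False] bs_q_def zexp_power by (simp add: field_simps)
qed

lemma bs_q_poly_moment:
  assumes P: "bs_admissible P" and k: "k \<le> l"
  shows "moment P (bs_q_poly P l * cos_poly k) = (if k = l then 1 else 0)"
proof -
  \<comment> \<open>On the circle \<open>H\<close> is \<open>z ^ l * den P z / num P z\<close> times
    \<open>cos_basis k\<close>. As \<open>k \<le> l\<close>, no negative power occurs, and
    \<open>H 0\<close> is 1 exactly if \<open>k = l\<close>.\<close>
  define H where "H z = (if k = 0 then z ^ l else z ^ (l + k) + z ^ (l - k)) * den P z / num P z" for z
  have "H holomorphic_on cball 0 1"
    unfolding H_def[abs_def] using num_nonzero[OF P]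
    by (cases "k = 0") (auto intro!: holomorphic_intros simp: den_def num_def)
  moreover have "H (cnj (zexp x)) = cnj (H (zexp x))" for x
    by (simp add: H_def num_cnj[OF P] den_cnj)
  ultimately have "((\<lambda>x. Re (H (zexp x))) has_integral pi * Re (H 0)) {0..pi}"
    by (rule mean_value_half_circle)
  moreover have "poly_fun (bs_q_poly P l * cos_poly k) x * bs_weight P x = Re (H (zexp x)) / pi" if "x \<in> {0..pi}" for x
  proof -
    let ?z = "zexp x"
    have S: "?z ^ l * of_real (cos_basis k x) = (if k = 0 then ?z ^ l else ?z ^ (l + k) + ?z ^ (l - k))"
    proof (cases "k = 0")
      case False
      have "of_real (2 * cos (real k * x)) = ?z ^ k + cnj (?z ^ k)"
        unfolding zexp_power by (simp add: complex_eq_iff Re_exp Im_exp)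
      moreover have "?z ^ l * cnj (?z ^ k) = ?z ^ (l - k)"
      proof -
        have "?z ^ l = ?z ^ (l - k) * ?z ^ k" using k by (simp flip: power_add)
        moreover have "?z ^ k * cnj (?z ^ k) = 1" by (simp flip: power_mult_distrib)
        ultimately show ?thesis by (simp add: mult.assoc)
      qed
      ultimately show ?thesis using False
        by (simp add: cos_basis_def power_add distrib_left)
    qed (simp add: cos_basis_def)
    have "H ?z = of_real (cos_basis k x) * (?z ^ l * den P ?z / num P ?z)"
      unfolding H_def S[symmetric] by (simp add: mult_ac)
    then have "Re (H ?z) = cos_basis k x * Re (?z ^ l * den P ?z / num P ?z)"
      by (simp only: Re_of_real_mult)
    moreover have "poly_fun (bs_q_poly P l * cos_poly k) x = poly_fun (bs_q_poly P l) x * cos_basis k x"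
      by (simp add: cos_basis_eq_poly_fun poly_fun_def)
    then have "poly_fun (bs_q_poly P l * cos_poly k) x * bs_weight P x = cos_basis k x * (poly_fun (bs_q_poly P l) x * bs_weight P x)"
      by simp
    ultimately show ?thesis
      unfolding bs_q_poly_weight[OF P that, of l] by simp
  qed
  ultimately have "((\<lambda>x. poly_fun (bs_q_poly P l * cos_poly k) x * bs_weight P x) has_integral Re (H 0)) {0..pi}"
    using has_integral_divide[of "\<lambda>x. Re (H (zexp x))" "pi * Re (H 0)" "{0..pi}" pi]
    by (subst has_integral_cong[where g = "\<lambda>x. Re (H (zexp x)) / pi"]) auto
  then have "moment P (bs_q_poly P l * cos_poly k) = Re (H 0)"
    unfolding moment_def by (rule integral_unique)
  also have "\<dots> = (if k = l then 1 else 0)"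
    using k by (auto simp: H_def den_def num_def power_0_left)
  finally show ?thesis .
qed

section \<open>Identification with the orthogonal polynomials\<close>

lemma bs_Delta_eq:
  assumes P: "bs_admissible P"
  shows "bs_Delta P l = monic_orthogonal.h (moment P) (bs_poly P) l"
    and "bs_Delta P l > 0"
proof -
  interpret monic_orthogonal "moment P" "bs_poly P" by (rule monic_orthogonal_bs_poly[OF P])
  have "bs_Delta P l = bs_inner P (poly_fun (bs_poly P l)) (poly_fun (bs_poly P l))"
    by (simp add: bs_Delta_def bs_inner_def bs_poly(3) power2_eq_square)
  then show "bs_Delta P l = h l" by (simp add: bs_inner_poly_fun[OF P] h_def)
  then show "bs_Delta P l > 0" by (simp add: h_pos)
qed

lemma bs_pp_eq_poly_fun: "bs_pp P l x = poly_fun (bs_poly P l) x / bs_Delta P l"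
  by (simp add: bs_pp_def bs_poly(3) divide_inverse mult.commute)

text \<open>By degree and orthogonality the explicit polynomial is a multiple \<kappa> of
  \<open>bs_poly P l\<close>. Its moment against the monic \<open>cos_poly l\<close> is 1, which
  gives \<kappa> as the inverse of \<open>bs_Delta P l\<close>; above \<open>d_eps P\<close> the
  leading coefficient shows \<kappa> to be 1.\<close>

lemma bs_large_degree:
  assumes P: "bs_admissible P" and l: "real l \<ge> d_eps P"
  shows "bs_pp P l x = poly_fun (bs_q_poly P l) x"
    and "real l > d_eps P \<Longrightarrow> bs_Delta P l = 1"
proof -
  interpret monic_orthogonal "moment P" "bs_poly P" by (rule monic_orthogonal_bs_poly[OF P])
  let ?q = "bs_q_poly P l" and ?p = "bs_poly P l" 
  define \<kappa> where "\<kappa> = coeff ?q l"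
  have lower: "moment P (?q * g) = 0" if "\<And>i. l \<le> i \<Longrightarrow> coeff g i = 0" for g
    by (rule L_orth_span[where b = cos_poly and n = l])
      (use that cos_poly_coeff_gt cos_poly_coeff_eq bs_q_poly_moment[OF P] in auto)
  have q: "?q = smult \<kappa> ?p"
    unfolding \<kappa>_def
  proof (rule orth_lower_unique)
    show "moment P (?q * bs_poly P k) = 0" if "k < l" for k
      using lower that bs_poly(1) by simp
  qed (use bs_q_poly_coeff(1)[OF P l] in auto)
  have "moment P (?q * (?p - cos_poly l)) = 0"
  proof (rule lower)
    fix i assume "l \<le> i"
    then show "coeff (?p - cos_poly l) i = 0"
      using bs_poly(1)[where l = l and P = P] bs_poly(2)[where l = l and P = P] cos_poly_coeff_gt[of l i] cos_poly_coeff_eq[of l]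
      by (cases "i = l") auto
  qed
  then have "moment P (?q * ?p) = 1"
    using bs_q_poly_moment[OF P order_refl, of l] by (simp add: right_diff_distrib L_minus)
  then have \<kappa>: "\<kappa> * bs_Delta P l = 1"
    by (simp add: q L_smult bs_Delta_eq[OF P] h_def)
  then show "bs_pp P l x = poly_fun ?q x"
    using bs_Delta_eq(2)[OF P, of l]
    by (simp add: bs_pp_eq_poly_fun q poly_fun_def field_simps)
  show "bs_Delta P l = 1" if "real l > d_eps P"
    using \<kappa> bs_q_poly_coeff(2)[OF P l that] by (simp add: \<kappa>_def)
qed

subsection \<open>Christoffel-Darboux kernels\<close>

text \<open>The real factor that remains of 1 / c(-x) once the half phase is split off.\<close>

definition bs_amp :: "bs_params \<Rightarrow> real \<Rightarrow> real" where
  "bs_amp P x = Re (cnj (zexp (phase P x / 2)) * (den P (zexp x) / num P (zexp x)))"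

text \<open>By \<open>exp_phase\<close> the number \<open>y\<close>, which is the quotient freed
  from its half phase, equals its own conjugate.\<close>

lemma bs_amp:
  assumes P: "bs_admissible P"
  shows "den P (zexp x) / num P (zexp x) = zexp (phase P x / 2) * of_real (bs_amp P x)"
proof -
  let ?z = "zexp x"
  define E where "E = zexp (phase P x / 2)"
  define D where "D = den P ?z"
  define N where "N = num P ?z"
  define y where "y = cnj E * (D / N)"
  have N: "N \<noteq> 0" "cnj N \<noteq> 0" using num_nonzero[OF P, of ?z] by (simp_all add: N_def)
  have EE: "E * cnj E = 1" unfolding E_def by (rule zexp_mult_cnj)
  have "E * E = zexp (phase P x)"
    unfolding E_def zexp_add[symmetric] by (simp only: field_sum_of_halves)
  then have "E * E * N * cnj D = cnj N * D"
    using exp_phase[OF P, of x] by (simp add: D_def N_def num_cnj[OF P] den_cnj)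
  then have "cnj E * (E * E * N * cnj D) = cnj E * (cnj N * D)" by simp
  moreover have "cnj E * (E * E * N * cnj D) = (E * cnj E) * (E * N * cnj D)"
    by (simp only: mult_ac)
  ultimately have "E * N * cnj D = cnj E * cnj N * D"
    using EE by simp
  then have "cnj y = y"
    using N by (simp add: y_def field_simps)
  then have "of_real (Re y) = y"
    by (intro of_real_Re) (simp only: Reals_cnj_iff)
  moreover have "E * y = D / N"
    using EE unfolding y_def by (metis mult.assoc mult_1)
  ultimately show ?thesis
    by (simp add: bs_amp_def y_def E_def D_def N_def)
qed

lemma continuous_phase: "bs_admissible P \<Longrightarrow> continuous_on A (phase P)"
  using phase_has_deriv
  by (intro continuous_at_imp_continuous_on ballI DERIV_isCont) blast

lemma continuous_bs_amp:
  assumes P: "bs_admissible P" shows "continuous_on A (bs_amp P)"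
  unfolding bs_amp_def[abs_def] num_def den_def
  by (intro continuous_intros continuous_phase P)
    (use num_nonzero[OF P, of "zexp _"] in \<open>auto simp: num_def\<close>)

text \<open>A basis function without its unimodular factor: real, and continuous also at the poles
  of c.\<close>

definition bs_f :: "bs_params \<Rightarrow> nat \<Rightarrow> real \<Rightarrow> real" where
  "bs_f P l x = bs_pp P l x * bs_amp P x"

lemma continuous_bs_f: "bs_admissible P \<Longrightarrow> continuous_on A (bs_f P l)"
  unfolding bs_f_def bs_pp_eq_poly_fun divide_inverse
  by (intro continuous_intros continuous_bs_amp continuous_poly_fun)

lemma bs_pp_over_c_minus:
  assumes P: "bs_admissible P"
  shows "of_real (bs_pp P l x) / bs_c P (- x) = zexp (phase P x / 2) * of_real (bs_f P l x)"
proof -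
  have "of_real (bs_pp P l x) / bs_c P (- x) = of_real (bs_pp P l x) * (den P (zexp x) / num P (zexp x))"
    unfolding bs_c_eq zexp_minus by simp
  then show ?thesis unfolding bs_amp[OF P] by (simp add: bs_f_def)
qed

lemma bs_pp_over_c:
  assumes P: "bs_admissible P"
  shows "of_real (bs_pp P l x) / bs_c P x = cnj (zexp (phase P x / 2)) * of_real (bs_f P l x)"
  using arg_cong[OF bs_pp_over_c_minus[OF P, of l x], of cnj] by (simp add: bs_c_minus[OF P])

text \<open>In the explicit form of the polynomial the amplitude cancels the modulus of c, and only
  the phase remains.\<close>

lemma bs_f_large:
  assumes P: "bs_admissible P" and nz: "den P (zexp x) \<noteq> 0" and l: "real l \<ge> d_eps P"
  shows "bs_f P l x = 2 * cos (real l * x + phase P x / 2)"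
proof -
  let ?z = "zexp x" and ?E = "zexp (phase P x / 2)"
  have N: "num P ?z \<noteq> 0" using num_nonzero[OF P, of ?z] by simp
  have "cnj ?E * (den P ?z / num P ?z) = of_real (bs_amp P x)"
    unfolding bs_amp[OF P] mult.assoc[symmetric] zexp_mult_cnj by simp
  then have "of_real (bs_amp P x) * (cnj (zexp (real l * x)) * num P ?z / den P ?z) = 
     cnj (zexp (real l * x + phase P x / 2))"
    using N nz unfolding zexp_add by (simp only: complex_cnj_mult) (simp add: field_simps)
  from arg_cong[OF this, of Re]
  have "bs_amp P x * Re (cnj (zexp (real l * x)) * num P ?z / den P ?z) = cos (real l * x + phase P x / 2)"
    unfolding Re_of_real_mult cnj.sel by (simp add: Re_exp)
  then have "Re (cnj (zexp (real l * x)) * num P ?z / den P ?z) * bs_amp P x = cos (real l * x + phase P x / 2)"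
    by (simp only: mult.commute)
  then show ?thesis
    unfolding bs_f_def bs_large_degree(1)[OF P l] bs_q_poly_eval[OF P nz] bs_q_def by (simp only: mult.assoc)
qed

text \<open>The Christoffel-Darboux kernel. Since \<open>bs_f\<close> carries the polynomials
  divided by their squared norm, the weight is \<open>bs_Delta\<close> and not its inverse.\<close>

definition bs_kernel :: "bs_params \<Rightarrow> nat \<Rightarrow> real \<Rightarrow> real \<Rightarrow> real" where
  "bs_kernel P n x y = (\<Sum>l<n. bs_Delta P l * bs_f P l x * bs_f P l y)"

text \<open>Christoffel-Darboux in the variable 2 cos x. The bound on \<open>n\<close> puts both
  boundary indices \<open>n - 1\<close> and \<open>n\<close> into the range of the cosine
  formula.\<close>

lemma bs_kernel_off_diagonal:
  assumes P: "bs_admissible P" and n: "real n \<ge> d_eps P + 1"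
    and x: "den P (zexp x) \<noteq> 0" and y: "den P (zexp y) \<noteq> 0"
  shows "(cos x - cos y) * bs_kernel P n x y =
     2 * (cos (real n * x + phase P x / 2) * cos ((real n - 1) * y + phase P y / 2)
        - cos ((real n - 1) * x + phase P x / 2) * cos (real n * y + phase P y / 2))"
proof (cases n)
  case 0
  \<comment> \<open>only possible for \<open>d_eps P = -1\<close>; then the phase is linear and the right-hand side vanishes\<close>
  then have "eps_plus P = 1" "eps_minus P = 1" "bs_d P = 0"
    using n bs_admissibleD(1,2)[OF P] by (auto simp: d_eps_def field_simps)
  then have "phase P t = 2 * t - pi" for t
    by (simp add: phase_def U_total_def d_eps_def)
  then have "(real n - 1) * t + phase P t / 2 = - (pi / 2)" for t
    using 0 by (simp add: field_simps)
  then show ?thesis using 0 by (simp add: bs_kernel_def)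
next
  case (Suc k)
  interpret monic_orthogonal "moment P" "bs_poly P" by (rule monic_orthogonal_bs_poly[OF P])
  have k: "real k \<ge> d_eps P" and k': "real (Suc k) > d_eps P" "real (Suc k) \<ge> d_eps P" using n Suc by auto
  have pos: "h l > 0" "h l \<noteq> 0" for l using h_pos[of l] by auto
  have f: "bs_f P l t = poly_fun (bs_poly P l) t / h l * bs_amp P t" for l t
    by (simp add: bs_f_def bs_pp_eq_poly_fun bs_Delta_eq(1)[OF P])
  have hk: "h (Suc k) = 1" using bs_large_degree(2)[OF P k'(2) k'(1)] by (simp add: bs_Delta_eq(1)[OF P])
  have "bs_kernel P n x y = (\<Sum>l<Suc k. poly (bs_poly P l) (2 * cos x) * poly (bs_poly P l) (2 * cos y) / h l) * (bs_amp P x * bs_amp P y)"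
    unfolding bs_kernel_def Suc sum_distrib_right f bs_Delta_eq(1)[OF P]
    by (intro sum.cong refl) (use pos in \<open>simp add: poly_fun_def field_simps\<close>)
  then have "(2 * cos x - 2 * cos y) * bs_kernel P n x y =
    (poly (bs_poly P (Suc k)) (2 * cos x) * poly (bs_poly P k) (2 * cos y) - poly (bs_poly P k) (2 * cos x) * poly (bs_poly P (Suc k)) (2 * cos y)) / h k
     * (bs_amp P x * bs_amp P y)"
    using Christoffel_Darboux[of "2 * cos x" "2 * cos y" k] by (simp only: mult.assoc[symmetric])
  also have "\<dots> = bs_f P (Suc k) x * bs_f P k y - bs_f P k x * bs_f P (Suc k) y"
    using pos[of k] unfolding f hk by (simp add: poly_fun_def field_simps)
  also have "\<dots> = 4 * (cos (real n * x + phase P x / 2) * cos ((real n - 1) * y + phase P y / 2)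
        - cos ((real n - 1) * x + phase P x / 2) * cos (real n * y + phase P y / 2))"
    unfolding bs_f_large[OF P x k] bs_f_large[OF P y k] bs_f_large[OF P x k'(2)] bs_f_large[OF P y k'(2)]
    using Suc by (simp add: algebra_simps)
  finally show ?thesis by (simp add: algebra_simps)
qed

definition phase_deriv :: "bs_params \<Rightarrow> real \<Rightarrow> real" where
  "phase_deriv P x = u_total P x - 2 * d_eps P"

lemma continuous_phase_deriv:
  assumes "bs_admissible P" shows "continuous_on A (phase_deriv P)"
  unfolding phase_deriv_def[abs_def] u_total_def[abs_def]
  using bs_admissibleD(3)[OF assms]
  by (intro continuous_intros continuous_u_fun) auto

lemma continuous_bs_kernel:
  "bs_admissible P \<Longrightarrow> continuous_on A (\<lambda>x. bs_kernel P n x x)"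
  "bs_admissible P \<Longrightarrow> continuous_on A (\<lambda>x. bs_kernel P n x y)"
  unfolding bs_kernel_def by (intro continuous_intros continuous_bs_f; assumption)+

lemma den_nonzero_interior: "bs_admissible P \<Longrightarrow> x \<in> {0<..<pi} \<Longrightarrow> den P (zexp x) \<noteq> 0"
  using den_eq_0_iff[of P x] by auto

text \<open>Divide the off-diagonal identity for \<open>t\<close> and \<open>x\<close> by
  \<open>t - x\<close> and let \<open>t\<close> tend to \<open>x\<close>.\<close>

lemma bs_kernel_diagonal:
  assumes P: "bs_admissible P" and n: "real n \<ge> d_eps P + 1" and x: "x \<in> {0<..<pi}"
  shows "sin x * bs_kernel P n x x =
     (2 * real n - 1 + phase_deriv P x) * sin x + sin ((2 * real n - 1) * x + phase P x)"
proof -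
  define A where "A t = real n * t + phase P t / 2" for t
  define B where "B t = (real n - 1) * t + phase P t / 2" for t
  define R where "R t = 2 * (cos (A t) * cos (B x) - cos (B t) * cos (A x))" for t
  define g where "g = phase_deriv P x / 2"
  have dA: "(A has_real_derivative real n + g) (at x)"
    unfolding A_def g_def phase_deriv_def by (auto intro!: derivative_eq_intros phase_has_deriv[OF P])
  have dB: "(B has_real_derivative real n - 1 + g) (at x)"
    unfolding B_def g_def phase_deriv_def by (auto intro!: derivative_eq_intros phase_has_deriv[OF P])
  have "(R has_real_derivative 2 * (- sin (A x) * (real n + g) * cos (B x) + sin (B x) * (real n - 1 + g) * cos (A x))) (at x)"
    unfolding R_def by (auto intro!: derivative_eq_intros dA dB)
  then have lim1: "((\<lambda>t. (R t - R x) / (t - x)) \<longlongrightarrow>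
      2 * (- sin (A x) * (real n + g) * cos (B x) + sin (B x) * (real n - 1 + g) * cos (A x))) (at x)"
    by (simp add: has_field_derivative_iff)
  have "(cos has_real_derivative - sin x) (at x)" by (auto intro!: derivative_eq_intros)
  moreover have "((\<lambda>t. bs_kernel P n t x) \<longlongrightarrow> bs_kernel P n x x) (at x)"
    using continuous_bs_kernel(2)[OF P, of UNIV n x] by (simp add: continuous_on_def)
  ultimately have "((\<lambda>t. (cos t - cos x) / (t - x) * bs_kernel P n t x) \<longlongrightarrow> - sin x * bs_kernel P n x x) (at x)"
    by (intro tendsto_mult) (simp_all add: has_field_derivative_iff)
  moreover have "\<forall>\<^sub>F t in at x. t \<in> {0<..<pi}"
    using x by (intro eventually_at_in_open') auto
  then have "\<forall>\<^sub>F t in at x. (cos t - cos x) / (t - x) * bs_kernel P n t x = (R t - R x) / (t - x)"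
  proof eventually_elim
    case (elim t)
    then have "(cos t - cos x) * bs_kernel P n t x = R t"
      unfolding R_def A_def B_def
      using x by (intro bs_kernel_off_diagonal P n den_nonzero_interior)
    then show ?case by (simp add: R_def)
  qed
  ultimately have "((\<lambda>t. (R t - R x) / (t - x)) \<longlongrightarrow> - sin x * bs_kernel P n x x) (at x)"
    by (rule Lim_transform_eventually)
  with lim1 have eq: "2 * (- sin (A x) * (real n + g) * cos (B x) + sin (B x) * (real n - 1 + g) * cos (A x)) = - sin x * bs_kernel P n x x"
    by (rule tendsto_unique[OF at_neq_bot])
  \<comment> \<open>The difference of the angles \<open>A x\<close> and \<open>B x\<close> is
    \<open>x\<close>; their sum is the argument of the second sine.\<close>
  have S1: "sin x = sin (A x) * cos (B x) - cos (A x) * sin (B x)"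
    by (simp add: A_def B_def algebra_simps flip: sin_diff)
  have S2: "sin ((2 * real n - 1) * x + phase P x) = sin (A x) * cos (B x) + cos (A x) * sin (B x)"
  proof -
    have "(2 * real n - 1) * x + phase P x = A x + B x"
      by (simp add: A_def B_def field_simps)
    then show ?thesis by (simp only: sin_add)
  qed
  show ?thesis
    using eq unfolding S1 S2 g_def by (simp add: algebra_simps)
qed

text \<open>Divide the diagonal identity by \<open>sin t\<close> and approach the endpoint from
  inside: the quotient of sines tends to the same limit as the other summand, hence the factor
  2.\<close>

lemma bs_kernel_endpoint:
  assumes P: "bs_admissible P" and n: "real n \<ge> d_eps P + 1"
    and x: "x = 0 \<or> x = pi" and nz: "den P (zexp x) \<noteq> 0"
  shows "bs_kernel P n x x = 2 * (2 * real n - 1 + phase_deriv P x)"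
proof -
  define A where "A t = (2 * real n - 1) * t + phase P t" for t
  define F where "F = at x within {0<..<pi}"
  have "F \<noteq> bot"
    using x unfolding F_def trivial_limit_within by (auto simp: islimpt_greaterThanLessThan1 islimpt_greaterThanLessThan2)
  \<comment> \<open>As \<open>den\<close> does not vanish here, the sign belonging to this endpoint
    is 0, and so is the phase.\<close>
  have "phase P x = 0"
    using den_eq_0_iff[OF P, of x] nz x bs_admissibleD(1,2)[OF P] by (auto simp: phase_ends)
  then have "A x = 2 * real n * x - x"
    by (simp add: A_def algebra_simps)
  then have A: "sin (A x) = 0" "cos (A x) = cos x"
    using x by (auto simp: cos_diff sin_diff)
  have sx: "sin x = 0" "cos x \<noteq> 0" using x by auto
  define a where "a = 2 * real n - 1 + phase_deriv P x"
  have dA: "(A has_real_derivative a) (at x within {0<..<pi})"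
    unfolding A_def a_def phase_deriv_def by (auto intro!: derivative_eq_intros phase_has_deriv[OF P])
  have "((\<lambda>t. sin (A t)) has_real_derivative cos (A x) * a) (at x within {0<..<pi})"
    by (auto intro!: derivative_eq_intros dA)
  then have "((\<lambda>t. sin (A t) / (t - x)) \<longlongrightarrow> cos x * a) F"
    using A by (simp add: has_field_derivative_iff F_def)
  moreover have "(sin has_real_derivative cos x) (at x within {0<..<pi})"
    by (auto intro!: derivative_eq_intros)
  then have "((\<lambda>t. sin t / (t - x)) \<longlongrightarrow> cos x) F"
    using sx by (simp add: has_field_derivative_iff F_def)
  ultimately have "((\<lambda>t. (sin (A t) / (t - x)) / (sin t / (t - x))) \<longlongrightarrow> cos x * a / cos x) F"
    using sx by (intro tendsto_divide)
  moreover have "((\<lambda>t. 2 * real n - 1 + phase_deriv P t) \<longlongrightarrow> a) F"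
    using continuous_phase_deriv[OF P, of UNIV] unfolding a_def F_def
    by (intro tendsto_intros) (auto simp: continuous_on_def intro: tendsto_within_subset)
  ultimately have "((\<lambda>t. (2 * real n - 1 + phase_deriv P t) + (sin (A t) / (t - x)) / (sin t / (t - x))) \<longlongrightarrow> a + cos x * a / cos x) F"
    by (intro tendsto_add)
  moreover have "\<forall>\<^sub>F t in F. t \<in> {0<..<pi}"
    unfolding F_def by (simp add: eventually_at_filter)
  then have "\<forall>\<^sub>F t in F. (2 * real n - 1 + phase_deriv P t) + (sin (A t) / (t - x)) / (sin t / (t - x)) = bs_kernel P n t t"
  proof eventually_elim
    case (elim t)
    then have "sin t > 0" "t - x \<noteq> 0" using x by (auto simp: sin_gt_zero)
    then have "(sin (A t) / (t - x)) / (sin t / (t - x)) = sin (A t) / sin t"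
      by simp
    moreover have "sin (A t) = sin t * (bs_kernel P n t t - (2 * real n - 1 + phase_deriv P t))"
      using bs_kernel_diagonal[OF P n elim] by (simp add: A_def right_diff_distrib mult.commute)
    ultimately show ?case
      using \<open>sin t > 0\<close> by simp
  qed
  ultimately have "((\<lambda>t. bs_kernel P n t t) \<longlongrightarrow> a + cos x * a / cos x) F"
    by (rule Lim_transform_eventually)
  moreover have "((\<lambda>t. bs_kernel P n t t) \<longlongrightarrow> bs_kernel P n x x) F"
    using continuous_bs_kernel(1)[OF P, of UNIV n] unfolding F_def
    by (auto simp: continuous_on_def intro: tendsto_within_subset)
  ultimately have "bs_kernel P n x x = a + cos x * a / cos x"
    using tendsto_unique[OF \<open>F \<noteq> bot\<close>] by blast
  then show ?thesis using sx by (simp add: a_def)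
qed

subsection \<open>The composite basis\<close>

locale composite_bs =
  fixes P Q :: bs_params and m :: nat
  assumes P: "bs_admissible P" and Q: "bs_admissible Q"
    and m_pos: "m > 0" and m_gt: "int m > \<lceil>d_eps P\<rceil> + \<lceil>d_eps Q\<rceil>"
begin

text \<open>The constants in the phases absorb the signs, so that the node equation reads
  \<open>total x = 2 * pi * real j\<close>.\<close>

definition total :: "real \<Rightarrow> real" where
  "total x = 2 * real m * x + phase P x + phase Q x"

definition total_deriv :: "real \<Rightarrow> real" where
  "total_deriv x = 2 * real m + phase_deriv P x + phase_deriv Q x"

lemma total_has_deriv: "(total has_real_derivative total_deriv x) (at x)"
  unfolding total_def total_deriv_def phase_deriv_def
  by (auto intro!: derivative_eq_intros phase_has_deriv P Q)

lemma total_deriv_eq: "total_deriv x = 2 * (real m - d_eps P - d_eps Q) + u_total P x + u_total Q x"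
  by (simp add: total_deriv_def phase_deriv_def)

lemma total_deriv_pos: "total_deriv x > 0"
proof -
  have "d_eps P + d_eps Q \<le> of_int (\<lceil>d_eps P\<rceil> + \<lceil>d_eps Q\<rceil>)"
    by (simp add: add_mono)
  also have "\<dots> < of_int (int m)" using m_gt by (simp only: of_int_less_iff)
  finally show ?thesis
    using u_total_nonneg[OF P, of x] u_total_nonneg[OF Q, of x] by (simp add: total_deriv_eq)
qed

lemma total_strict_mono: "x < y \<Longrightarrow> total x < total y"
  using DERIV_pos_imp_increasing[of x y total] total_has_deriv total_deriv_pos by blast

lemma total_ends:
  "total 0 = - pi * real (eps_minus P + eps_minus Q)"
  "total pi = 2 * pi * real m + pi * real (eps_plus P + eps_plus Q)"
  by (simp_all add: total_def phase_ends algebra_simps)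

lemma is_bs_node_iff: "is_bs_node P Q m j x \<longleftrightarrow> total x = 2 * pi * real j"
proof -
  have "(\<Sum>r=1..bs_d R. LBINT x=0..x. u_fun (bs_alpha R r) x) = of_real (U_total R x)" if "bs_admissible R" for R
    unfolding of_real_U_total[OF that] 
    by (intro sum.cong refl LBINT_u_fun bs_admissibleD(3)[OF that])
  then have "is_bs_node P Q m j x \<longleftrightarrow> 
     complex_of_real (2 * (real m - d_eps P - d_eps Q) * x + U_total P x + U_total Q x) =
     complex_of_real (pi * real (2 * j + eps_minus P + eps_minus Q))"
    unfolding is_bs_node_def using P Q by simp
  also have "\<dots> \<longleftrightarrow> total x = 2 * pi * real j"
    unfolding of_real_eq_iff total_def phase_def by (auto simp: algebra_simps)
  finally show ?thesis .
qed

abbreviation X :: "nat \<Rightarrow> real" where "X j \<equiv> bs_node P Q m j"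

text \<open>Existence in the interval by the intermediate value theorem, uniqueness among all reals
  by strict monotonicity of \<open>total\<close>.\<close>

lemma node:
  assumes "j \<le> m" shows "total (X j) = 2 * pi * real j" "X j \<in> {0..pi}"
proof -
  have "continuous_on {0..pi} total"
    using total_has_deriv by (intro continuous_at_imp_continuous_on ballI) (blast intro: DERIV_isCont)
  moreover have "total 0 \<le> 2 * pi * real j"
    unfolding total_ends by (rule order_trans[of _ 0]) simp_all
  moreover have "2 * pi * real j \<le> total pi"
    unfolding total_ends using assms by (simp add: add_increasing2)
  ultimately obtain x where x: "x \<in> {0..pi}" "total x = 2 * pi * real j"
    using IVT'[of total 0 "2 * pi * real j" pi] by auto
  have "X j = x"
    unfolding bs_node_def is_bs_node_iff
  proof (rule the_equality)
    fix y assume "total y = 2 * pi * real j"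
    then show "y = x" using x total_strict_mono[of x y] total_strict_mono[of y x] by (cases x y rule: linorder_cases) auto
  qed (use x in simp)
  with x show "total (X j) = 2 * pi * real j" "X j \<in> {0..pi}" by auto
qed

lemma total_inj: "total x = total y \<longleftrightarrow> x = y"
  using total_strict_mono[of x y] total_strict_mono[of y x] by (cases x y rule: linorder_cases) auto

lemma node_eq_0_iff: "j \<le> m \<Longrightarrow> X j = 0 \<longleftrightarrow> j = 0 \<and> eps_minus P = 0 \<and> eps_minus Q = 0"
proof -
  assume "j \<le> m"
  have "X j = 0 \<longleftrightarrow> total (X j) = total 0" by (rule total_inj[symmetric])
  also have "\<dots> \<longleftrightarrow> pi * real (2 * j + eps_minus P + eps_minus Q) = 0"
    unfolding node[OF \<open>j \<le> m\<close>] total_ends by (auto simp: algebra_simps)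
  also have "\<dots> \<longleftrightarrow> 2 * j + eps_minus P + eps_minus Q = 0"
    by (simp only: mult_eq_0_iff pi_neq_zero of_nat_eq_0_iff simp_thms)
  finally show ?thesis by simp
qed

lemma node_eq_pi_iff: "j \<le> m \<Longrightarrow> X j = pi \<longleftrightarrow> j = m \<and> eps_plus P = 0 \<and> eps_plus Q = 0"
proof -
  assume j: "j \<le> m"
  have "X j = pi \<longleftrightarrow> total (X j) = total pi" by (rule total_inj[symmetric])
  also have "\<dots> \<longleftrightarrow> pi * real (2 * (m - j) + eps_plus P + eps_plus Q) = 0"
    unfolding node[OF j] total_ends using j by (auto simp: of_nat_diff algebra_simps)
  also have "\<dots> \<longleftrightarrow> 2 * (m - j) + eps_plus P + eps_plus Q = 0"
    by (simp only: mult_eq_0_iff pi_neq_zero of_nat_eq_0_iff simp_thms)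
  finally show ?thesis using j by auto
qed

text \<open>An endpoint is a node only if its signs vanish in both families, so a zero of either
  denominator is never hit.\<close>

lemma den_node:
  assumes "j \<le> m" shows "den P (zexp (X j)) \<noteq> 0" "den Q (zexp (X j)) \<noteq> 0"
  using den_eq_0_iff[OF P, of "X j"] den_eq_0_iff[OF Q, of "X j"] node_eq_0_iff[OF assms]
    node_eq_pi_iff[OF assms] node(2)[OF assms] by auto

text \<open>The sum over \<open>l \<le> m\<close> is cut between two indices at which both expressions for the
  basis are valid: \<open>n\<close> terms are taken from the family P, the remaining \<open>n'\<close> from Q.\<close>

definition n :: nat where "n = nat (\<lceil>d_eps P\<rceil> + 1)"
definition n' :: nat where "n' = m + 1 - n"

text \<open>\<open>n\<close> is the least index fit for the kernel of P, and the bound on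
  \<open>m\<close> leaves enough terms for that of Q. As \<open>d_eps\<close> is at least -1, the
  conversion to \<open>nat\<close> loses nothing, and \<open>n = 0\<close> can occur.\<close>

lemma cut:
  shows "n + n' = m + 1" "real n \<ge> d_eps P + 1" "real n' \<ge> d_eps Q + 1"
    and "l < n \<Longrightarrow> real l < real m - d_eps Q" "n \<le> l \<Longrightarrow> real l > d_eps P"
proof -
  have "d_eps R \<ge> -1" if "bs_admissible R" for R
    using bs_admissibleD(1,2)[OF that] by (auto simp: d_eps_def field_simps)
  then have c: "\<lceil>d_eps P\<rceil> \<ge> -1" "\<lceil>d_eps Q\<rceil> \<ge> -1"
    using P Q by (force simp: le_ceiling_iff)+
  then have n: "int n = \<lceil>d_eps P\<rceil> + 1" by (simp add: n_def)
  show nn: "n + n' = m + 1" using n c m_gt by (simp add: n'_def)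
  then have n': "int n' = int m - \<lceil>d_eps P\<rceil>" using n by linarith
  have ceil: "d_eps P \<le> of_int \<lceil>d_eps P\<rceil>" "d_eps Q \<le> of_int \<lceil>d_eps Q\<rceil>" by simp_all
  show "real n \<ge> d_eps P + 1" using n ceil(1) by linarith
  have "real_of_int \<lceil>d_eps Q\<rceil> + 1 \<le> real n'" using n' m_gt by linarith
  then show "real n' \<ge> d_eps Q + 1" using ceil(2) by linarith
  show "real l < real m - d_eps Q" if "l < n"
  proof -
    have "real l \<le> real m - of_int \<lceil>d_eps Q\<rceil> - 1" using n m_gt that by linarith
    then show ?thesis using ceil(2) by linarith
  qed
  show "real l > d_eps P" if "n \<le> l"
    using n ceil(1) that by linarith
qed

lemma sum_cut: "(\<Sum>l\<le>m. g l) = (\<Sum>l<n. g l) + (\<Sum>k<n'. g (m - k))"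
proof -
  have "(\<Sum>l\<le>m. g l) = sum g {..<n + n'}"
    using cut(1) by (simp add: lessThan_Suc_atMost)
  also have "{..<n + n'} = {..<n} \<union> {n..<n + n'}" by auto
  also have "sum g \<dots> = sum g {..<n} + sum g {n..<n + n'}"
    by (rule sum.union_disjoint) auto
  also have "sum g {n..<n + n'} = (\<Sum>k<n'. g (m - k))"
    using cut(1) by (intro sum.reindex_bij_witness[of _ "\<lambda>k. m - k" "\<lambda>l. m - l"]) auto
  finally show ?thesis .
qed

text \<open>The unimodular factor shared by all basis functions at the node, independent of
  \<open>l\<close>.\<close>

definition \<theta> :: "nat \<Rightarrow> complex" where
  "\<theta> j = zexp (real m * X j / 2 + phase P (X j) / 2)"

lemma psi_lower:
  assumes "l < n" 
  shows "bs_psi P Q m l (X j) = \<theta> j * of_real (bs_f P l (X j))"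
proof -
  have "exp (\<i> / 2 * of_nat m * of_real x) = zexp (real m * x / 2)" for x :: real
    by (simp add: mult_ac)
  then show ?thesis
    using cut(4)[OF assms] unfolding bs_psi_def \<theta>_def zexp_add bs_pp_over_c_minus[OF P] by simp
qed

text \<open>If \<open>bs_psi\<close> uses the expression of P, both families are given by cosines
  whose arguments add up to \<pi>j by the node equation. Otherwise that equation turns the phase
  factor of Q into \<theta> up to (-1)^j.\<close>

lemma psi_upper:
  assumes j: "j \<le> m" and l: "n \<le> l" "l \<le> m"
  shows "bs_psi P Q m l (X j) = \<theta> j * of_real ((-1) ^ j * bs_f Q (m - l) (X j))"
proof -
  have x: "total (X j) = 2 * pi * real j" by (rule node[OF j])
  show ?thesis
  proof (cases "real l \<le> real m - d_eps Q")
    case True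
    have "real (m - l) * X j + phase Q (X j) / 2 = real j * pi - (real l * X j + phase P (X j) / 2)"
      using x l unfolding total_def by (simp add: of_nat_diff algebra_simps)
    then have "bs_f Q (m - l) (X j) = 2 * cos (real j * pi - (real l * X j + phase P (X j) / 2))"
      using True l by (subst bs_f_large[OF Q den_node(2)[OF j]]) (auto simp: of_nat_diff)
    also have "\<dots> = (-1) ^ j * bs_f P l (X j)"
      using cut(5)[OF l(1)] by (subst bs_f_large[OF P den_node(1)[OF j]]) (auto simp: cos_diff)
    finally have "(-1) ^ j * bs_f Q (m - l) (X j) = bs_f P l (X j)" by simp
    moreover have "exp (\<i> / 2 * of_nat m * of_real x) = zexp (real m * x / 2)" for x :: real
      by (simp add: mult_ac)
    ultimately show ?thesis
      using True unfolding bs_psi_def \<theta>_def zexp_add bs_pp_over_c_minus[OF P] by simp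
  next
    case False
    have "real m * X j / 2 + phase P (X j) / 2 = - (real m * X j / 2 + phase Q (X j) / 2) + real j * pi"
      using x unfolding total_def by (simp add: field_simps)
    then have "\<theta> j = cnj (zexp (real m * X j / 2)) * cnj (zexp (phase Q (X j) / 2)) * zexp (real j * pi)"
      unfolding \<theta>_def by (simp only: zexp_add zexp_minus complex_cnj_mult)
    moreover have "zexp (real j * pi) = (-1) ^ j"
      unfolding zexp_power[symmetric] by simp
    ultimately have \<theta>: "\<theta> j * of_real ((-1) ^ j) = cnj (zexp (real m * X j / 2)) * cnj (zexp (phase Q (X j) / 2))"
      by (simp flip: mult.assoc power_mult_distrib) 
    have "exp (- \<i> / 2 * of_nat m * of_real x) = cnj (zexp (real m * x / 2))" for x :: real
      unfolding zexp_minus[symmetric] by (simp add: mult_ac)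
    then have "bs_psi P Q m l (X j) = cnj (zexp (real m * X j / 2)) * (cnj (zexp (phase Q (X j) / 2)) * of_real (bs_f Q (m - l) (X j)))"
      using False unfolding bs_psi_def bs_pp_over_c[OF Q] by simp
    also have "\<dots> = \<theta> j * of_real ((-1) ^ j) * of_real (bs_f Q (m - l) (X j))"
      unfolding \<theta> by (simp only: mult.assoc)
    finally show ?thesis by (simp only: of_real_mult mult.assoc)
  qed
qed

text \<open>Indices in the middle branch lie above \<open>d_eps P\<close>, where
  \<open>bs_Delta P l\<close> is 1 as well.\<close>

lemma Delta_m_lower: "l < n \<Longrightarrow> bs_Delta_m P Q m l = bs_Delta P l"
  using cut(4)[of l] bs_large_degree(2)[OF P, of l] by (auto simp: bs_Delta_m_def)

lemma Delta_m_upper: "n \<le> l \<Longrightarrow> l \<le> m \<Longrightarrow> bs_Delta_m P Q m l = bs_Delta Q (m - l)"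
  using cut(5)[of l] bs_large_degree(2)[OF Q, of "m - l"] by (auto simp: bs_Delta_m_def of_nat_diff)

lemma Delta_m_pos: "l \<le> m \<Longrightarrow> bs_Delta_m P Q m l > 0"
  using Delta_m_lower[of l] Delta_m_upper[of l] bs_Delta_eq(2)[OF P] bs_Delta_eq(2)[OF Q]
  by (cases "l < n") auto

lemma kernel_eq:
  assumes "i \<le> m" "j \<le> m"
  shows "(\<Sum>l\<le>m. bs_psi P Q m l (X i) * cnj (bs_psi P Q m l (X j)) * complex_of_real (bs_Delta_m P Q m l)) =
     \<theta> i * cnj (\<theta> j) * of_real (bs_kernel P n (X i) (X j) + (-1) ^ (i + j) * bs_kernel Q n' (X i) (X j))"
proof -
  have lower: "bs_psi P Q m l (X i) * cnj (bs_psi P Q m l (X j)) * complex_of_real (bs_Delta_m P Q m l) =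
     \<theta> i * cnj (\<theta> j) * of_real (bs_Delta P l * bs_f P l (X i) * bs_f P l (X j))" if "l < n" for l
    using that by (simp add: psi_lower Delta_m_lower mult_ac)
  have upper: "bs_psi P Q m (m - k) (X i) * cnj (bs_psi P Q m (m - k) (X j)) * complex_of_real (bs_Delta_m P Q m (m - k)) =
     \<theta> i * cnj (\<theta> j) * of_real ((-1) ^ (i + j) * (bs_Delta Q k * bs_f Q k (X i) * bs_f Q k (X j)))" if "k < n'" for k
  proof -
    have "n \<le> m - k" "m - (m - k) = k" using that cut(1) by auto
    then show ?thesis
      using assms by (simp add: psi_upper Delta_m_upper power_add mult_ac)
  qed
  show ?thesis
    unfolding sum_cut by (simp add: lower upper bs_kernel_def distrib_left sum_distrib_left)
qed

text \<open>As n + n' - 1 = m, the node equation exchanges the boundary indices: up to (-1)^k, index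
  n' of Q matches n - 1 of P, and n' - 1 matches n. The boundary terms of the two kernels are then
  opposite.\<close>

lemma kernel_off_diagonal:
  assumes i: "i \<le> m" and j: "j \<le> m" and "i \<noteq> j"
  shows "bs_kernel P n (X i) (X j) + (-1) ^ (i + j) * bs_kernel Q n' (X i) (X j) = 0"
proof -
  define A where "A x = real n * x + phase P x / 2" for x
  define B where "B x = (real n - 1) * x + phase P x / 2" for x
  have n': "real n' = real m + 1 - real n" using cut(1) by linarith
  have flip: "cos (real n' * X k + phase Q (X k) / 2) = (-1) ^ k * cos (B (X k))"
     "cos ((real n' - 1) * X k + phase Q (X k) / 2) = (-1) ^ k * cos (A (X k))" if "k \<le> m" for k
  proof -
    have "total (X k) = 2 * pi * real k" by (rule node[OF that])
    then have "real n' * X k + phase Q (X k) / 2 = real k * pi - B (X k)"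
      "(real n' - 1) * X k + phase Q (X k) / 2 = real k * pi - A (X k)"
      unfolding total_def A_def B_def n' by (simp_all add: field_simps)
    then show "cos (real n' * X k + phase Q (X k) / 2) = (-1) ^ k * cos (B (X k))"
     "cos ((real n' - 1) * X k + phase Q (X k) / 2) = (-1) ^ k * cos (A (X k))"
      by (simp_all add: cos_diff)
  qed
  have KP: "(cos (X i) - cos (X j)) * bs_kernel P n (X i) (X j) =
      2 * (cos (A (X i)) * cos (B (X j)) - cos (B (X i)) * cos (A (X j)))"
    unfolding A_def B_def by (rule bs_kernel_off_diagonal[OF P cut(2) den_node(1)[OF i] den_node(1)[OF j]])
  have "(cos (X i) - cos (X j)) * bs_kernel Q n' (X i) (X j) =
      2 * ((-1) ^ i * cos (B (X i)) * ((-1) ^ j * cos (A (X j))) - (-1) ^ i * cos (A (X i)) * ((-1) ^ j * cos (B (X j))))"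
    unfolding bs_kernel_off_diagonal[OF Q cut(3) den_node(2)[OF i] den_node(2)[OF j]] flip[OF i] flip[OF j] ..
  also have "\<dots> = (-1) ^ (i + j) * (2 * (cos (B (X i)) * cos (A (X j)) - cos (A (X i)) * cos (B (X j))))"
    by (simp add: power_add algebra_simps)
  finally have KQ: "(-1) ^ (i + j) * ((cos (X i) - cos (X j)) * bs_kernel Q n' (X i) (X j)) =
      2 * (cos (B (X i)) * cos (A (X j)) - cos (A (X i)) * cos (B (X j)))"
    by (simp flip: mult.assoc power_add)
  have "(cos (X i) - cos (X j)) * (bs_kernel P n (X i) (X j) + (-1) ^ (i + j) * bs_kernel Q n' (X i) (X j)) =
     (cos (X i) - cos (X j)) * bs_kernel P n (X i) (X j) + (-1) ^ (i + j) * ((cos (X i) - cos (X j)) * bs_kernel Q n' (X i) (X j))"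
    by (simp add: distrib_left mult.left_commute)
  also have "\<dots> = 0" unfolding KP KQ by simp
  finally have "(cos (X i) - cos (X j)) * (bs_kernel P n (X i) (X j) + (-1) ^ (i + j) * bs_kernel Q n' (X i) (X j)) = 0" .
  moreover have "cos (X i) \<noteq> cos (X j)"
  proof
    assume "cos (X i) = cos (X j)"
    then have "X i = X j" using cos_inj_pi node(2)[OF i] node(2)[OF j] by simp
    then have "total (X i) = total (X j)" by (rule arg_cong)
    then have "2 * pi * real i = 2 * pi * real j" unfolding node(1)[OF i] node(1)[OF j] .
    then show False using \<open>i \<noteq> j\<close> by simp
  qed
  ultimately show ?thesis by simp
qed

text \<open>At an interior node the arguments of the two sine terms add up to a multiple of 2\<pi>,
  so these terms cancel and the derivative of \<open>total\<close> is left. At an endpoint both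
  kernels are doubled.\<close>

lemma kernel_diagonal:
  assumes i: "i \<le> m"
  shows "bs_kernel P n (X i) (X i) + bs_kernel Q n' (X i) (X i) =
    (if X i = 0 \<or> X i = pi then 2 else 1) * total_deriv (X i)"
proof (cases "X i = 0 \<or> X i = pi")
  case True
  have "real n + real n' = real m + 1" using cut(1) by linarith
  then show ?thesis
    using True bs_kernel_endpoint[OF P cut(2) True den_node(1)[OF i]] bs_kernel_endpoint[OF Q cut(3) True den_node(2)[OF i]]
    by (simp add: total_deriv_def)
next
  case False
  then have x: "X i \<in> {0<..<pi}" using node(2)[OF i] by auto
  let ?x = "X i"
  have n': "real n' = real m + 1 - real n" using cut(1) by linarith
  have "(2 * real n' - 1) * ?x + phase Q ?x = 2 * real i * pi - ((2 * real n - 1) * ?x + phase P ?x)"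
    using node(1)[OF i] unfolding total_def n' by (simp add: algebra_simps)
  then have "sin ((2 * real n' - 1) * ?x + phase Q ?x) = - sin ((2 * real n - 1) * ?x + phase P ?x)"
    by (simp add: sin_diff)
  then have "sin ?x * (bs_kernel P n ?x ?x + bs_kernel Q n' ?x ?x) = sin ?x * total_deriv ?x"
    using bs_kernel_diagonal[OF P cut(2) x] bs_kernel_diagonal[OF Q cut(3) x]
    unfolding n' total_deriv_def by (simp add: algebra_simps)
  then show ?thesis using False x sin_gt_zero[of ?x] by simp
qed

lemma hat_Delta_eq:
  assumes i: "i \<le> m"
  shows "bs_hat_Delta P Q m i = 1 / of_real ((if X i = 0 \<or> X i = pi then 2 else 1) * total_deriv (X i))"
proof -
  \<comment> \<open>The exponent flags the nodes at 0 and \<pi>; as \<open>m > 0\<close>, the two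
    indicators never hold together.\<close>
  have e: "(1 - eps_minus P) * (1 - eps_minus Q) * of_bool (i = 0) + (1 - eps_plus P) * (1 - eps_plus Q) * of_bool (m - i = 0)
     = (if X i = 0 \<or> X i = pi then 1 else 0 :: nat)"
    unfolding node_eq_0_iff[OF i] node_eq_pi_iff[OF i]
    using i m_pos bs_admissibleD(1,2)[OF P] bs_admissibleD(1,2)[OF Q] by auto
  have s: "of_real (2 * (real m - d_eps P - d_eps Q)) + (\<Sum>r=1..bs_d P. u_fun (bs_alpha P r) (X i))
       + (\<Sum>r=1..bs_d Q. u_fun (bs_alpha Q r) (X i)) = complex_of_real (total_deriv (X i))"
    by (simp only: total_deriv_eq of_real_add of_real_u_total[OF P] of_real_u_total[OF Q])
  have "(1 / 2) ^ (if b then 1 else 0) * inverse (of_real t) = 1 / complex_of_real ((if b then 2 else 1) * t)" for b t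
    by (cases b) (simp_all add: field_simps)
  then show ?thesis
    unfolding bs_hat_Delta_def e s .
qed

lemma hat_Delta_nonzero: "i \<le> m \<Longrightarrow> bs_hat_Delta P Q m i \<noteq> 0"
  using total_deriv_pos[of "X i"] by (simp add: hat_Delta_eq)

lemma dual_orthogonality:
  assumes "i \<le> m" "j \<le> m"
  shows "(\<Sum>l\<le>m. bs_psi P Q m l (X i) * cnj (bs_psi P Q m l (X j)) * complex_of_real (bs_Delta_m P Q m l))
     = (if j = i then 1 / bs_hat_Delta P Q m i else 0)"
proof (cases "i = j")
  case True
  have "\<theta> i * cnj (\<theta> i) = 1" unfolding \<theta>_def by (rule zexp_mult_cnj)
  then show ?thesis
    using True assms kernel_diagonal[of i]
    by (simp only: kernel_eq hat_Delta_eq) (simp flip: mult_2)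
next
  case False
  then show ?thesis using assms by (simp add: kernel_eq kernel_off_diagonal del: of_real_add of_real_mult)
qed

lemma orthogonality:
  assumes "l \<le> m" "k \<le> m"
  shows "(\<Sum>j\<le>m. bs_psi P Q m l (X j) * cnj (bs_psi P Q m k (X j)) * bs_hat_Delta P Q m j)
     = (if k = l then 1 / complex_of_real (bs_Delta_m P Q m l) else 0)"
proof -
  \<comment> \<open>With both weights placed in \<open>M\<close>, the dual relation says that
    \<open>M\<close> times \<open>K\<close> is the identity; the reversed product is the claim
    multiplied by \<open>bs_Delta_m P Q m l\<close>.\<close>
  define M where "M i l = bs_hat_Delta P Q m i * bs_psi P Q m l (X i) * complex_of_real (bs_Delta_m P Q m l)" for i l
  define K where "K l j = cnj (bs_psi P Q m l (X j))" for l j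
  have "(\<Sum>j<Suc m. K k j * M j l) = (if k = l then 1 else 0)"
  proof (rule biorthogonal_flip)
    fix i j assume "i < Suc m" "j < Suc m"
    then have ij: "i \<le> m" "j \<le> m" by auto
    have "(\<Sum>l<Suc m. M i l * K l j) = bs_hat_Delta P Q m i * 
      (\<Sum>l\<le>m. bs_psi P Q m l (X i) * cnj (bs_psi P Q m l (X j)) * complex_of_real (bs_Delta_m P Q m l))"
      unfolding M_def K_def sum_distrib_left lessThan_Suc_atMost by (simp add: mult_ac)
    then show "(\<Sum>l<Suc m. M i l * K l j) = (if i = j then 1 else 0)"
      unfolding dual_orthogonality[OF ij] using hat_Delta_nonzero[OF ij(1)] by auto
  qed (use assms in auto)
  moreover have "(\<Sum>j<Suc m. K k j * M j l) = 
     (\<Sum>j\<le>m. bs_psi P Q m l (X j) * cnj (bs_psi P Q m k (X j)) * bs_hat_Delta P Q m j) * complex_of_real (bs_Delta_m P Q m l)"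
    unfolding M_def K_def sum_distrib_right lessThan_Suc_atMost by (simp add: mult_ac)
  ultimately show ?thesis
    using Delta_m_pos[OF assms(1)] by (auto simp: field_simps)
qed

end

theorem theorem1:
  fixes P Q :: bs_params and m :: nat
  assumes "bs_admissible P" and "bs_admissible Q"
    and "m > 0" and "int m > \<lceil>d_eps P\<rceil> + \<lceil>d_eps Q\<rceil>"
  shows "(\<forall>l\<le>m. \<forall>k\<le>m.
            (\<Sum>j\<le>m. bs_psi P Q m l (bs_node P Q m j) * cnj (bs_psi P Q m k (bs_node P Q m j))
                     * bs_hat_Delta P Q m j)
            = (if k = l then 1 / complex_of_real (bs_Delta_m P Q m l) else 0))
       \<and> (\<forall>i\<le>m. \<forall>j\<le>m.
            (\<Sum>l\<le>m. bs_psi P Q m l (bs_node P Q m i) * cnj (bs_psi P Q m l (bs_node P Q m j))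
                     * complex_of_real (bs_Delta_m P Q m l))
            = (if j = i then 1 / bs_hat_Delta P Q m i else 0))"
proof -
  interpret composite_bs P Q m by unfold_locales (use assms in auto)
  show ?thesis using orthogonality dual_orthogonality by blast
qed

end
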